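(* Let $P$ be $\mathbb{R}^2$ equipped with the pencil diffeology, let $I_0(P)$ be the ideal of germs at $0$ of smooth functions on $P$ that vanish at $0$, and let $E_0(P)=I_0(P)/I_0(P)^2$ be the Zariski cotangent space of $P$ at $0$. The map $$\tilde J\colon I_0(P)\to\prod_{L\in\mathbb{RP}^1}L^*,\qquad \tilde J(f)=\bigl(d_0(f|_L)\bigr)_{L\in\mathbb{RP}^1},$$ is a smooth linear map. Its kernel satisfies $$\ker\tilde J=I_0(P)^2.$$ Hence it descends to a smooth injective linear map $$J\colon E_0(P)\hookrightarrow\prod_{L\in\mathbb{RP}^1}L^*,\qquad [F]\mapsto\bigl(d_0(F|_L)\bigr)_{L\in\mathbb{RP}^1}.$$
   Context: Diffeologies. A parametrization of a set $X$ is a map $U\to X$ with $U$ open in some $\mathbb{R}^n$, $n\ge0$. A diffeology on $X$ is a set of parametrizations, called plots, such that: every constant parametrization is a plot; a parametrization that is a plot on each member of some open cover of its domain is a plot; and the composite of a plot $U\to X$ with an ordinary smooth map $V\to U$ ($V\subset\mathbb{R}^m$ open) is a plot. A map $f\colon X\to Y$ of diffeological spaces is smooth if $f\circ p$ is a plot of $Y$ for every plot $p$ of $X$. The $D$-topology on $X$ is the finest topology making all plots continuous. Product diffeology: plots are the componentwise plots. Subset diffeology on $Y\subset X$: plots are parametrizations of $Y$ that are plots of $X$. Quotient diffeology: the final diffeology for the quotient map (plots are the parametrizations that locally lift to plots upstairs). Functional diffeology on $C^\infty(X,Y)$: $q\colon U\to C^\infty(X,Y)$ is a plot iff $U\times X\to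 Y$, $(u,x)\mapsto q(u)(x)$, is smooth. Euclidean open sets and finite-dimensional real vector spaces carry their standard diffeology (plots are the ordinary smooth maps). Pencil diffeology. $P$ is the set $\mathbb{R}^2$ with the following plots: $p\colon U\to\mathbb{R}^2$ is a plot iff every $u_0\in U$ has an open neighborhood $V\subset U$ such that either (1) $p(u_0)\ne0$ and $p|_V$ is ordinary smooth, or (2) $p(u_0)=0$ and there is a line $L\subset\mathbb{R}^2$ through the origin such that $p(V)\subset L$ and $p|_V\colon V\to L$ is ordinary smooth. Germs. For a based diffeological space $(X,x)$, $G(X,x)=\operatorname{colim}_{x\in B}C^\infty(B,\mathbb{R})$ over $D$-open neighborhoods $B$ of $x$ (each with the subset diffeology), equipped with the quotient diffeology from the coproduct (disjoint union) of the functional diffeologies on the $C^\infty(B,\mathbb{R})$; it is a diffeological $\mathbb{R}$-algebra under pointwise operations. $I_x(X)=\{f\in G(X,x): f(x)=0\}$ has the subset diffeology; $I_x(X)^2$ is the ideal of finite sums of products $fg$ with $f,g\in I_x(X)$; $E_x(X)=I_x(X)/I_x(X)^2$ has the quotient diffeology. Linewise derivatives. $\mathbb{RP}^1$ is the set of lines through the origin in $\mathbb{R}^2$; $L^*$ is the ordinary dual of the line $L$. For $f\in I_0(P)$, $d_0(f|_L)\in L^*$ is the ordinary derivative at $0$ of the restriction to $L$ of any representative of $f$. The product $\prod_{L}L^*$ carries the product diffeology. *)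

theory Defs
  imports "HOL-Analysis.Analysis" "HOL-Algebra.Ideal_Product" "HOL-Algebra.Module"
begin

section \<open>Smooth maps on open subsets of Euclidean spaces\<close>

text \<open>Parametrizations have domains in spaces of every dimension, so the dimension has to be a
  term: an open subset of $n$-space is an open set of the library topology
  \<^term>\<open>Euclidean_space n\<close>, whose points are the sequences vanishing from index \<open>n\<close> on.
  Below, \<^term>\<open>deriv (\<lambda>t. f (u(i := t))) (u i)\<close> is the \<open>i\<close>-th partial derivative of \<open>f\<close>
  at \<open>u\<close>. For \<open>U\<close> open all of this depends only on the values of \<open>f\<close> on \<open>U\<close>.\<close>

primrec Ck_on :: "nat \<Rightarrow> nat \<Rightarrow> (nat \<Rightarrow> real) set \<Rightarrow> ((nat \<Rightarrow> real) \<Rightarrow> real) \<Rightarrow> bool" where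
  "Ck_on 0 n U f \<longleftrightarrow> continuous_map (subtopology (Euclidean_space n) U) euclideanreal f"
| "Ck_on (Suc k) n U f \<longleftrightarrow>
     continuous_map (subtopology (Euclidean_space n) U) euclideanreal f \<and>
     (\<forall>i<n. (\<forall>u\<in>U. (\<lambda>t. f (u(i := t))) differentiable at (u i)) \<and>
            Ck_on k n U (\<lambda>u. deriv (\<lambda>t. f (u(i := t))) (u i)))"

definition smooth_real :: "nat \<Rightarrow> (nat \<Rightarrow> real) set \<Rightarrow> ((nat \<Rightarrow> real) \<Rightarrow> real) \<Rightarrow> bool" where
  "smooth_real n U f \<longleftrightarrow> (\<forall>k. Ck_on k n U f)"

definition smooth_euclidean ::
    "nat \<Rightarrow> (nat \<Rightarrow> real) set \<Rightarrow> ((nat \<Rightarrow> real) \<Rightarrow> 'e::euclidean_space) \<Rightarrow> bool" where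
  "smooth_euclidean n U p \<longleftrightarrow> (\<forall>b\<in>Basis. smooth_real n U (\<lambda>u. p u \<bullet> b))"

definition smooth_coord ::
    "nat \<Rightarrow> (nat \<Rightarrow> real) set \<Rightarrow> nat \<Rightarrow> ((nat \<Rightarrow> real) \<Rightarrow> (nat \<Rightarrow> real)) \<Rightarrow> bool" where
  "smooth_coord m V n h \<longleftrightarrow> (\<forall>i<n. smooth_real m V (\<lambda>v. h v i))"


section \<open>Diffeological spaces\<close>

text \<open>The triple \<open>(n, U, p)\<close> stands for the parametrization $p|_U$ with \<open>U\<close> open in $n$-space;
  the values of the total function \<open>p\<close> outside \<open>U\<close> are irrelevant, and all sets of plots below
  are invariant under changing them.\<close>

type_synonym 'a param = "nat \<times> (nat \<Rightarrow> real) set \<times> ((nat \<Rightarrow> real) \<Rightarrow> 'a)"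

record 'a diff_space =
  points :: "'a set"
  plots :: "'a param set"

definition parametrizations :: "'a set \<Rightarrow> 'a param set" where
  "parametrizations X = {(n, U, p). openin (Euclidean_space n) U \<and> p ` U \<subseteq> X}"

text \<open>The axioms of a diffeology. The constructions below are given by explicit sets of plots and
  do not refer to the axioms. Taking \<open>h\<close> to be the identity, the last clause also says that being
  a plot depends only on the values on the domain.\<close>

definition diffeological :: "'a diff_space \<Rightarrow> bool" where
  "diffeological X \<longleftrightarrow>
     plots X \<subseteq> parametrizations (points X) \<and>
     (\<forall>n U. \<forall>x\<in>points X. openin (Euclidean_space n) U \<longrightarrow> (n, U, \<lambda>_. x) \<in> plots X) \<and>
     (\<forall>n U p. (n, U, p) \<in> parametrizations (points X) \<and>
        (\<forall>u\<in>U. \<exists>V. openin (Euclidean_space n) V \<and> u \<in> V \<and> V \<subseteq> U \<and> (n, V, p) \<in> plots X)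
        \<longrightarrow> (n, U, p) \<in> plots X) \<and>
     (\<forall>n U p m V h q. (n, U, p) \<in> plots X \<and> openin (Euclidean_space m) V \<and> h ` V \<subseteq> U \<and>
        smooth_coord m V n h \<and> (\<forall>v\<in>V. q v = p (h v))
        \<longrightarrow> (m, V, q) \<in> plots X)"

definition diff_smooth :: "'a diff_space \<Rightarrow> 'b diff_space \<Rightarrow> ('a \<Rightarrow> 'b) \<Rightarrow> bool" where
  "diff_smooth X Y f \<longleftrightarrow>
     f \<in> points X \<rightarrow> points Y \<and> (\<forall>n U p. (n, U, p) \<in> plots X \<longrightarrow> (n, U, f \<circ> p) \<in> plots Y)"

definition smooth_maps :: "'a diff_space \<Rightarrow> 'b diff_space \<Rightarrow> ('a \<Rightarrow> 'b) set" where
  "smooth_maps X Y = {f \<in> points X \<rightarrow>\<^sub>E points Y. diff_smooth X Y f}"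

definition D_topology :: "'a diff_space \<Rightarrow> 'a topology" where
  "D_topology X = topology (\<lambda>A. A \<subseteq> points X \<and>
     (\<forall>n U p. (n, U, p) \<in> plots X \<longrightarrow> openin (Euclidean_space n) {u \<in> U. p u \<in> A}))"

definition diff_euclidean :: "'e::euclidean_space set \<Rightarrow> 'e diff_space" where
  "diff_euclidean S = \<lparr>points = S,
     plots = {(n, U, p) \<in> parametrizations S. smooth_euclidean n U p}\<rparr>"

abbreviation diff_real :: "real diff_space" where
  "diff_real \<equiv> diff_euclidean UNIV"

definition diff_open :: "nat \<Rightarrow> (nat \<Rightarrow> real) set \<Rightarrow> (nat \<Rightarrow> real) diff_space" where
  "diff_open n U = \<lparr>points = U,
     plots = {(m, V, h) \<in> parametrizations U. smooth_coord m V n h}\<rparr>"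

definition diff_sub :: "'a diff_space \<Rightarrow> 'a set \<Rightarrow> 'a diff_space" where
  "diff_sub X A = \<lparr>points = A, plots = {(n, U, p) \<in> plots X. p ` U \<subseteq> A}\<rparr>"

definition diff_pair :: "'a diff_space \<Rightarrow> 'b diff_space \<Rightarrow> ('a \<times> 'b) diff_space" where
  "diff_pair X Y = \<lparr>points = points X \<times> points Y,
     plots = {(n, U, p) \<in> parametrizations (points X \<times> points Y).
                (n, U, fst \<circ> p) \<in> plots X \<and> (n, U, snd \<circ> p) \<in> plots Y}\<rparr>"

definition diff_prod :: "'i set \<Rightarrow> ('i \<Rightarrow> 'a diff_space) \<Rightarrow> ('i \<Rightarrow> 'a) diff_space" where
  "diff_prod I X = \<lparr>points = (\<Pi>\<^sub>E i\<in>I. points (X i)),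
     plots = {(n, U, p) \<in> parametrizations (\<Pi>\<^sub>E i\<in>I. points (X i)).
                \<forall>i\<in>I. (n, U, \<lambda>u. p u i) \<in> plots (X i)}\<rparr>"

definition diff_coprod :: "'i set \<Rightarrow> ('i \<Rightarrow> 'a diff_space) \<Rightarrow> ('i \<times> 'a) diff_space" where
  "diff_coprod I X = \<lparr>points = (SIGMA i:I. points (X i)),
     plots = {(n, U, p) \<in> parametrizations (SIGMA i:I. points (X i)).
                \<forall>u\<in>U. \<exists>V i q. openin (Euclidean_space n) V \<and> u \<in> V \<and> V \<subseteq> U \<and>
                  i \<in> I \<and> (n, V, q) \<in> plots (X i) \<and> (\<forall>v\<in>V. p v = (i, q v))}\<rparr>"

text \<open>The quotient of \<open>X\<close> along the surjection \<open>\<pi>\<close> from \<open>points X\<close> onto its image.\<close>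

definition diff_quot :: "('a \<Rightarrow> 'b) \<Rightarrow> 'a diff_space \<Rightarrow> 'b diff_space" where
  "diff_quot \<pi> X = \<lparr>points = \<pi> ` points X,
     plots = {(n, U, p) \<in> parametrizations (\<pi> ` points X).
                \<forall>u\<in>U. \<exists>V q. openin (Euclidean_space n) V \<and> u \<in> V \<and> V \<subseteq> U \<and>
                  (n, V, q) \<in> plots X \<and> (\<forall>v\<in>V. p v = \<pi> (q v))}\<rparr>"

definition diff_fun :: "'a diff_space \<Rightarrow> 'b diff_space \<Rightarrow> ('a \<Rightarrow> 'b) diff_space" where
  "diff_fun X Y = \<lparr>points = smooth_maps X Y,
     plots = {(n, U, q) \<in> parametrizations (smooth_maps X Y).
                diff_smooth (diff_pair (diff_open n U) X) Y (\<lambda>(u, x). q u x)}\<rparr>"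

text \<open>The D-topology is a topology, all plots are continuous for it, and it is the finest such
  topology on the set of points.\<close>

lemma openin_D_topology:
  "openin (D_topology X) A \<longleftrightarrow> A \<subseteq> points X \<and>
     (\<forall>n U p. (n, U, p) \<in> plots X \<longrightarrow> openin (Euclidean_space n) {u \<in> U. p u \<in> A})"
proof -
  have "istopology (\<lambda>A. A \<subseteq> points X \<and>
     (\<forall>n U p. (n, U, p) \<in> plots X \<longrightarrow> openin (Euclidean_space n) {u \<in> U. p u \<in> A}))"
    unfolding istopology_def
  proof (intro conjI allI impI)
    fix S T n U p
    assume S: "S \<subseteq> points X \<and>
        (\<forall>n U p. (n, U, p) \<in> plots X \<longrightarrow> openin (Euclidean_space n) {u \<in> U. p u \<in> S})"
      and T: "T \<subseteq> points X \<and>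
        (\<forall>n U p. (n, U, p) \<in> plots X \<longrightarrow> openin (Euclidean_space n) {u \<in> U. p u \<in> T})"
    show "S \<inter> T \<subseteq> points X"
      using S by blast
    assume "(n, U, p) \<in> plots X"
    moreover have "{u \<in> U. p u \<in> S \<inter> T} = {u \<in> U. p u \<in> S} \<inter> {u \<in> U. p u \<in> T}"
      by blast
    ultimately show "openin (Euclidean_space n) {u \<in> U. p u \<in> S \<inter> T}"
      using S T by (auto intro: openin_Int)
  next
    fix \<K> n U p
    assume K: "\<forall>A\<in>\<K>. A \<subseteq> points X \<and>
        (\<forall>n U p. (n, U, p) \<in> plots X \<longrightarrow> openin (Euclidean_space n) {u \<in> U. p u \<in> A})"
    show "\<Union>\<K> \<subseteq> points X"
      using K by blast
    assume "(n, U, p) \<in> plots X"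
    moreover have "{u \<in> U. p u \<in> \<Union>\<K>} = (\<Union>A\<in>\<K>. {u \<in> U. p u \<in> A})"
      by blast
    ultimately show "openin (Euclidean_space n) {u \<in> U. p u \<in> \<Union>\<K>}"
      using K by (auto intro!: openin_Union)
  qed
  then show ?thesis
    by (simp add: D_topology_def topology_inverse')
qed

lemma D_topology_continuous:
  assumes "plots X \<subseteq> parametrizations (points X)" "(n, U, p) \<in> plots X"
  shows "continuous_map (subtopology (Euclidean_space n) U) (D_topology X) p"
proof -
  have U: "openin (Euclidean_space n) U" and pU: "p ` U \<subseteq> points X"
    using assms by (auto simp: parametrizations_def)
  have "openin (D_topology X) (points X)"
    unfolding openin_D_topology
  proof (intro conjI allI impI)
    fix m V q assume "(m, V, q) \<in> plots X"
    then have "openin (Euclidean_space m) V" "q ` V \<subseteq> points X"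
      using assms(1) by (auto simp: parametrizations_def)
    moreover from this have "{v \<in> V. q v \<in> points X} = V"
      by blast
    ultimately show "openin (Euclidean_space m) {v \<in> V. q v \<in> points X}"
      by simp
  qed simp
  then have "points X \<subseteq> topspace (D_topology X)"
    by (rule openin_subset)
  moreover have "topspace (subtopology (Euclidean_space n) U) = U"
    using openin_subset[OF U] by auto
  ultimately show ?thesis
    using assms(2) pU U
    by (auto simp: continuous_map_def openin_D_topology openin_open_subtopology)
qed

lemma D_topology_finest:
  assumes "plots X \<subseteq> parametrizations (points X)" "topspace T = points X"
    and cont: "\<And>n U p. (n, U, p) \<in> plots X
                 \<Longrightarrow> continuous_map (subtopology (Euclidean_space n) U) T p"
    and "openin T A"
  shows "openin (D_topology X) A"
  unfolding openin_D_topology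
proof (intro conjI allI impI)
  show "A \<subseteq> points X"
    using assms(2) \<open>openin T A\<close> openin_subset by metis
  fix n U p assume p: "(n, U, p) \<in> plots X"
  then have U: "openin (Euclidean_space n) U"
    using assms(1) by (auto simp: parametrizations_def)
  have "topspace (subtopology (Euclidean_space n) U) = U"
    using openin_subset[OF U] by auto
  then show "openin (Euclidean_space n) {u \<in> U. p u \<in> A}"
    using cont[OF p] \<open>openin T A\<close> U
    by (auto simp: continuous_map_def openin_open_subtopology)
qed


section \<open>Real vector spaces\<close>

text \<open>Real vector spaces and algebras are \<^typ>\<open>(real, 'v) module\<close> records with scalars from the
  type \<^typ>\<open>real\<close>. For mere vector spaces the ring fields \<^const>\<open>mult\<close> and \<^const>\<open>one\<close> of the
  record are left unspecified.\<close>

definition linear_map ::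
    "(real, 'v, 'm) module_scheme \<Rightarrow> (real, 'w, 'n) module_scheme \<Rightarrow> ('v \<Rightarrow> 'w) \<Rightarrow> bool" where
  "linear_map M N T \<longleftrightarrow>
     T \<in> carrier M \<rightarrow> carrier N \<and>
     (\<forall>x\<in>carrier M. \<forall>y\<in>carrier M. T (x \<oplus>\<^bsub>M\<^esub> y) = T x \<oplus>\<^bsub>N\<^esub> T y) \<and>
     (\<forall>a. \<forall>x\<in>carrier M. T (a \<odot>\<^bsub>M\<^esub> x) = a \<odot>\<^bsub>N\<^esub> T x)"

definition real_space :: "(real, real) module" where
  "real_space = \<lparr>carrier = UNIV, mult = (*), one = 1, zero = 0, add = (+), smult = (*)\<rparr>"

text \<open>The standard diffeology of a finite-dimensional vector space: a map into it is smooth iff its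
  coordinates are, and the linear functionals are the linear combinations of coordinates.\<close>

definition diff_vector_space :: "(real, 'v, 'm) module_scheme \<Rightarrow> 'v diff_space" where
  "diff_vector_space M = \<lparr>points = carrier M,
     plots = {(n, U, p) \<in> parametrizations (carrier M).
                \<forall>l. linear_map M real_space l \<longrightarrow> smooth_real n U (l \<circ> p)}\<rparr>"

definition dual_space :: "'e::real_vector set \<Rightarrow> (real, 'e \<Rightarrow> real) module" where
  "dual_space L = \<lparr>
     carrier = {\<phi> \<in> extensional L. (\<forall>v\<in>L. \<forall>w\<in>L. \<phi> (v + w) = \<phi> v + \<phi> w) \<and>
                                   (\<forall>a. \<forall>v\<in>L. \<phi> (a *\<^sub>R v) = a * \<phi> v)},
     mult = undefined, one = undefined,
     zero = (\<lambda>v\<in>L. 0),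
     add = (\<lambda>\<phi> \<psi>. \<lambda>v\<in>L. \<phi> v + \<psi> v),
     smult = (\<lambda>a \<phi>. \<lambda>v\<in>L. a * \<phi> v)\<rparr>"

definition product_space :: "'i set \<Rightarrow> ('i \<Rightarrow> (real, 'v) module) \<Rightarrow> (real, 'i \<Rightarrow> 'v) module" where
  "product_space I M = \<lparr>
     carrier = (\<Pi>\<^sub>E i\<in>I. carrier (M i)),
     mult = undefined, one = undefined,
     zero = (\<lambda>i\<in>I. \<zero>\<^bsub>M i\<^esub>),
     add = (\<lambda>x y. \<lambda>i\<in>I. x i \<oplus>\<^bsub>M i\<^esub> y i),
     smult = (\<lambda>a x. \<lambda>i\<in>I. a \<odot>\<^bsub>M i\<^esub> x i)\<rparr>"

definition quotient_space :: "(real, 'v) module \<Rightarrow> 'v set \<Rightarrow> (real, 'v set) module" where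
  "quotient_space M H = \<lparr>
     carrier = a_rcosets\<^bsub>M\<^esub> H,
     mult = undefined, one = undefined,
     zero = H,
     add = set_add M,
     smult = (\<lambda>a c. \<Union>x\<in>c. H +>\<^bsub>M\<^esub> (a \<odot>\<^bsub>M\<^esub> x))\<rparr>"


section \<open>Germs and the Zariski cotangent space\<close>

definition D_nbhds :: "'a diff_space \<Rightarrow> 'a \<Rightarrow> 'a set set" where
  "D_nbhds X x = {B. openin (D_topology X) B \<and> x \<in> B}"

definition germ_reps :: "'a diff_space \<Rightarrow> 'a \<Rightarrow> ('a set \<times> ('a \<Rightarrow> real)) diff_space" where
  "germ_reps X x = diff_coprod (D_nbhds X x) (\<lambda>B. diff_fun (diff_sub X B) diff_real)"

text \<open>The colimit is realised as the set of equivalence classes of pairs \<open>(B, f)\<close>, two pairs being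
  identified if they have the same restriction to some smaller D-open neighbourhood.\<close>

definition germ_rel ::
    "'a diff_space \<Rightarrow> 'a \<Rightarrow> (('a set \<times> ('a \<Rightarrow> real)) \<times> ('a set \<times> ('a \<Rightarrow> real))) set" where
  "germ_rel X x = {((B, f), (B', f')).
     (B, f) \<in> points (germ_reps X x) \<and> (B', f') \<in> points (germ_reps X x) \<and>
     (\<exists>C\<in>D_nbhds X x. C \<subseteq> B \<inter> B' \<and> (\<forall>y\<in>C. f y = f' y))}"

type_synonym 'a germ = "('a set \<times> ('a \<Rightarrow> real)) set"

definition germ_class :: "'a diff_space \<Rightarrow> 'a \<Rightarrow> 'a set \<times> ('a \<Rightarrow> real) \<Rightarrow> 'a germ" where
  "germ_class X x r = germ_rel X x `` {r}"

definition diff_germs :: "'a diff_space \<Rightarrow> 'a \<Rightarrow> 'a germ diff_space" where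
  "diff_germs X x = diff_quot (germ_class X x) (germ_reps X x)"

definition germ_algebra :: "'a diff_space \<Rightarrow> 'a \<Rightarrow> (real, 'a germ) module" where
  "germ_algebra X x = \<lparr>
     carrier = points (germ_reps X x) // germ_rel X x,
     mult = (\<lambda>g h. \<Union>(B, f)\<in>g. \<Union>(B', f')\<in>h.
               germ_class X x (B \<inter> B', \<lambda>y\<in>B \<inter> B'. f y * f' y)),
     one = germ_class X x (points X, \<lambda>y\<in>points X. 1),
     zero = germ_class X x (points X, \<lambda>y\<in>points X. 0),
     add = (\<lambda>g h. \<Union>(B, f)\<in>g. \<Union>(B', f')\<in>h.
               germ_class X x (B \<inter> B', \<lambda>y\<in>B \<inter> B'. f y + f' y)),
     smult = (\<lambda>a g. \<Union>(B, f)\<in>g. germ_class X x (B, \<lambda>y\<in>B. a * f y))\<rparr>"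

definition vanishing_ideal :: "'a diff_space \<Rightarrow> 'a \<Rightarrow> 'a germ set" where
  "vanishing_ideal X x = {g \<in> carrier (germ_algebra X x). \<forall>(B, f)\<in>g. f x = 0}"

definition vanishing_ideal_sq :: "'a diff_space \<Rightarrow> 'a \<Rightarrow> 'a germ set" where
  "vanishing_ideal_sq X x =
     ideal_prod (germ_algebra X x) (vanishing_ideal X x) (vanishing_ideal X x)"

definition vanishing_space :: "'a diff_space \<Rightarrow> 'a \<Rightarrow> (real, 'a germ) module" where
  "vanishing_space X x = (germ_algebra X x)\<lparr>carrier := vanishing_ideal X x\<rparr>"

definition diff_vanishing :: "'a diff_space \<Rightarrow> 'a \<Rightarrow> 'a germ diff_space" where
  "diff_vanishing X x = diff_sub (diff_germs X x) (vanishing_ideal X x)"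

definition cotangent_class :: "'a diff_space \<Rightarrow> 'a \<Rightarrow> 'a germ \<Rightarrow> 'a germ set" where
  "cotangent_class X x g = vanishing_ideal_sq X x +>\<^bsub>vanishing_space X x\<^esub> g"

definition cotangent_space :: "'a diff_space \<Rightarrow> 'a \<Rightarrow> (real, 'a germ set) module" where
  "cotangent_space X x = quotient_space (vanishing_space X x) (vanishing_ideal_sq X x)"

definition diff_cotangent :: "'a diff_space \<Rightarrow> 'a \<Rightarrow> 'a germ set diff_space" where
  "diff_cotangent X x = diff_quot (cotangent_class X x) (diff_vanishing X x)"


section \<open>The pencil diffeology and linewise derivatives\<close>

definition RP1 :: "(real^2) set set" where
  "RP1 = {L. subspace L \<and> dim L = 1}"

definition pencil :: "(real^2) diff_space" where
  "pencil = \<lparr>points = UNIV,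
     plots = {(n, U, p) \<in> parametrizations UNIV.
       \<forall>u\<in>U. \<exists>V. openin (Euclidean_space n) V \<and> u \<in> V \<and> V \<subseteq> U \<and>
         (p u \<noteq> 0 \<and> smooth_euclidean n V p \<or>
          p u = 0 \<and> (\<exists>L\<in>RP1. p ` V \<subseteq> L \<and> smooth_euclidean n V p))}\<rparr>"

text \<open>The ordinary derivative $d_0(F|_L)$. Within the line \<open>L\<close> the Frechet derivative, as a map on
  the whole plane, is determined only on \<open>L\<close>, hence the restriction.\<close>

definition line_derivative :: "(real^2 \<Rightarrow> real) \<Rightarrow> (real^2) set \<Rightarrow> (real^2 \<Rightarrow> real)" where
  "line_derivative F L = restrict (frechet_derivative F (at 0 within L)) L"

definition J_tilde :: "(real^2) germ \<Rightarrow> (real^2) set \<Rightarrow> (real^2 \<Rightarrow> real)" where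
  "J_tilde g = (\<lambda>L\<in>RP1. line_derivative (snd (SOME r. r \<in> g)) L)"

definition dual_product :: "(real, (real^2) set \<Rightarrow> (real^2 \<Rightarrow> real)) module" where
  "dual_product = product_space RP1 dual_space"

definition diff_dual_product :: "((real^2) set \<Rightarrow> (real^2 \<Rightarrow> real)) diff_space" where
  "diff_dual_product = diff_prod RP1 (\<lambda>L. diff_vector_space (dual_space L))"

end

theory Submission
  imports Defs
begin

text \<open>
  At the origin, smoothness on the pencil is a condition on each line separately: a function on a
  D-open neighbourhood of \<open>0\<close> is smooth iff it is smooth in the ordinary sense away from \<open>0\<close> and its
  restriction to every line through \<open>0\<close> is smooth. Hence derivatives along lines are computed by
  one-variable calculus, and the product rule shows that they vanish on products of germs vanishing
  at \<open>0\<close>.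

  The map \<open>J_tilde\<close> is smooth because a plot of germs is locally a function \<open>q u x\<close> that is smooth in
  \<open>u\<close> and \<open>x\<close> together; its derivative along a direction \<open>v\<close> is the partial derivative of
  \<open>q u (t *\<^sub>R v)\<close> with respect to \<open>t\<close> at \<open>t = 0\<close>, which is smooth in \<open>u\<close>
  (\<open>diff_fun_line_derivative_smooth\<close>).

  The heart of the proof is that every germ \<open>f\<close> with vanishing linewise derivatives is a single
  product of two germs vanishing at \<open>0\<close>. One would like to divide \<open>f\<close> by a linear form, but a linear form
  vanishes on a whole line. The D-topology is fine enough to glue two linear forms. Remove from the
  plane the two parabolas $y = \pm x^2$, except for the origin. What remains is D-open, since a line
  through \<open>0\<close> has no other point of the parabolas near \<open>0\<close>. Put \<open>pivot\<close> equal to $y$ where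
  $|y| > x^2$ and to $x$ where $|y| < x^2$. It is smooth away from \<open>0\<close>, because the two regions are
  separated by the parabolas. Close to \<open>0\<close>, apart from \<open>0\<close> itself, the x-axis lies in the second region
  and every other line in the first, so on each line \<open>pivot\<close> is a nonzero linear form near \<open>0\<close>. Moreover \<open>pivot\<close> vanishes
  only at \<open>0\<close>. So the quotient of \<open>f\<close> by \<open>pivot\<close> is smooth away from \<open>0\<close>, and on a line it is
  $f(tv)/(ct)$ with $c \neq 0$, which is smooth by Hadamard's lemma (\<open>hadamard_quotient\<close>) and vanishes at $t = 0$
  because the derivative of \<open>f\<close> along the line does. This gives \<open>J_tilde_zero_imp_factor\<close> and with it
  the kernel of \<open>J_tilde\<close>; the map \<open>J_map\<close> induced on cosets of the kernel is then injective.
\<close>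

section \<open>Smooth functions on open subsets of Euclidean spaces\<close>

lemma Euclidean_space_top_of_set: "Euclidean_space n = top_of_set {x. \<forall>i\<ge>n. x i = 0}"
  by (simp add: Euclidean_space_def euclidean_product_topology)

lemma openin_Euclidean_space:
  "openin (Euclidean_space n) U \<longleftrightarrow> (\<exists>T. open T \<and> U = {x. \<forall>i\<ge>n. x i = 0} \<inter> T)"
  by (auto simp: Euclidean_space_top_of_set openin_open)

lemma continuous_map_Euclidean_space:
  assumes "openin (Euclidean_space n) U"
  shows "continuous_map (subtopology (Euclidean_space n) U) euclidean f \<longleftrightarrow> continuous_on U f"
proof -
  have "{x. \<forall>i\<ge>n. x i = 0} \<inter> U = U"
    using assms by (auto simp: openin_Euclidean_space)
  then show ?thesis
    by (simp add: Euclidean_space_top_of_set subtopology_subtopology)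
qed

lemma openin_Euclidean_Int:
  assumes "openin (Euclidean_space n) U" "open T"
  shows "openin (Euclidean_space n) (U \<inter> T)"
proof -
  obtain S where "open S" "U = {x. \<forall>i\<ge>n. x i = 0} \<inter> S"
    using assms(1) unfolding openin_Euclidean_space by blast
  then have "open (S \<inter> T) \<and> U \<inter> T = {x. \<forall>i\<ge>n. x i = 0} \<inter> (S \<inter> T)"
    using assms(2) by (simp add: Int_assoc open_Int)
  then show ?thesis
    unfolding openin_Euclidean_space by blast
qed

lemma openin_Euclidean_preimage:
  assumes "openin (Euclidean_space n) U" "continuous_on U f" "open T"
  shows "openin (Euclidean_space n) {u \<in> U. f u \<in> T}"
proof -
  obtain A where A: "open A" "A \<inter> U = f -` T \<inter> U"
    using assms(2,3) unfolding continuous_on_open_invariant by blast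
  then have "{u \<in> U. f u \<in> T} = U \<inter> A"
    by auto
  with A assms(1) show ?thesis
    by (simp add: openin_Euclidean_Int)
qed

lemma openin_Euclidean_space_local:
  assumes "\<And>u. u \<in> A \<Longrightarrow> \<exists>V. openin (Euclidean_space n) V \<and> u \<in> V \<and> V \<subseteq> A"
  shows "openin (Euclidean_space n) A"
  unfolding openin_subopen[of _ A] using assms by simp

lemma continuous_on_Euclidean_local:
  assumes U: "openin (Euclidean_space n) U"
    and loc: "\<And>u. u \<in> U \<Longrightarrow> \<exists>V. openin (Euclidean_space n) V \<and> u \<in> V \<and> V \<subseteq> U \<and> continuous_on V f"
  shows "continuous_on U f"
  unfolding continuous_on_eq_continuous_within
proof
  fix u assume u: "u \<in> U"
  then obtain V where V: "openin (Euclidean_space n) V" "u \<in> V" "V \<subseteq> U" "continuous_on V f"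
    using loc by blast
  obtain T where T: "open T" "V = {x. \<forall>i\<ge>n. x i = 0} \<inter> T"
    using V(1) by (auto simp: openin_Euclidean_space)
  have "U \<subseteq> {x. \<forall>i\<ge>n. x i = 0}"
    using U by (auto simp: openin_Euclidean_space)
  then have "at u within U = at u within V"
    using T V(2,3) by (intro at_within_nhd[of u T]) auto
  then show "continuous (at u within U) f"
    using V by (simp add: continuous_on_eq_continuous_within)
qed

text \<open>
  Partial derivatives at a point of an open set therefore depend only on the values on that set, which
  makes \<open>Ck_on\<close> a local notion.
\<close>
lemma eventually_coordinate_line_in_open:
  assumes U: "openin (Euclidean_space n) U" and u: "u \<in> U" and i: "i < n"
  shows "\<forall>\<^sub>F t in nhds (u i). u(i := t) \<in> U"
proof -
  obtain T where T: "open T" "U = {x. \<forall>i\<ge>n. x i = 0} \<inter> T"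
    using U by (auto simp: openin_Euclidean_space)
  have "continuous_on UNIV (\<lambda>t. u(i := t))"
  proof (rule continuous_on_coordinatewise_then_product)
    show "continuous_on UNIV (\<lambda>t. (u(i := t)) j)" for j
      by (cases "j = i") auto
  qed
  then have "open ((\<lambda>t. u(i := t)) -` T)"
    using T(1) by (simp add: continuous_on_open_vimage)
  moreover have "u i \<in> (\<lambda>t. u(i := t)) -` T"
    using u T by auto
  ultimately have "\<forall>\<^sub>F t in nhds (u i). t \<in> (\<lambda>t. u(i := t)) -` T"
    by (rule eventually_nhds_in_open)
  then show ?thesis
    by (rule eventually_mono) (use u T i in auto)
qed

lemma Ck_on_continuous_on:
  assumes "openin (Euclidean_space n) U" "Ck_on k n U f"
  shows "continuous_on U f"
  using assms by (cases k) (auto simp: continuous_map_Euclidean_space)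

lemma Ck_on_cong:
  assumes "openin (Euclidean_space n) U" "\<And>u. u \<in> U \<Longrightarrow> f u = g u" "Ck_on k n U f"
  shows "Ck_on k n U g"
  using assms(2,3)
proof (induction k arbitrary: f g)
  case 0
  then show ?case
    using assms(1) by (simp add: continuous_map_Euclidean_space cong: continuous_on_cong)
next
  case (Suc k)
  have cont: "continuous_on U g"
    using Suc.prems assms(1)
    by (auto simp: continuous_map_Euclidean_space cong: continuous_on_cong)
  have ev: "\<forall>\<^sub>F t in nhds (u i). f (u(i := t)) = g (u(i := t))" if "u \<in> U" "i < n" for u i
    using eventually_coordinate_line_in_open[OF assms(1) that]
    by (rule eventually_mono) (use Suc.prems(1) in auto)
  have "(\<lambda>t. g (u(i := t))) differentiable at (u i)" if "u \<in> U" "i < n" for u i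
  proof -
    have "(\<lambda>t. f (u(i := t))) differentiable at (u i)"
      using Suc.prems(2) that by simp
    then show ?thesis
      using DERIV_cong_ev[OF refl ev[OF that] refl] by (auto simp: real_differentiable_def)
  qed
  moreover have "Ck_on k n U (\<lambda>u. deriv (\<lambda>t. g (u(i := t))) (u i))" if "i < n" for i
  proof (rule Suc.IH)
    show "Ck_on k n U (\<lambda>u. deriv (\<lambda>t. f (u(i := t))) (u i))"
      using Suc.prems(2) that by simp
    show "deriv (\<lambda>t. f (u(i := t))) (u i) = deriv (\<lambda>t. g (u(i := t))) (u i)" if "u \<in> U" for u
      using that \<open>i < n\<close> by (intro deriv_cong_ev ev) auto
  qed
  ultimately show ?case
    using cont assms(1) by (simp add: continuous_map_Euclidean_space)
qed

text \<open>
  The rules of differentiation produce derivatives in relational form. With this rule and the next one,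
  inductions on the order of differentiability can use any functions \<open>g i\<close> with the values of the
  partial derivatives instead of \<open>deriv\<close>.
\<close>
lemma Ck_on_SucI:
  assumes U: "openin (Euclidean_space n) U" and cont: "continuous_on U f"
    and der: "\<And>i u. i < n \<Longrightarrow> u \<in> U \<Longrightarrow> ((\<lambda>t. f (u(i := t))) has_real_derivative g i u) (at (u i))"
    and Ck: "\<And>i. i < n \<Longrightarrow> Ck_on k n U (g i)"
  shows "Ck_on (Suc k) n U f"
proof -
  have "(\<lambda>t. f (u(i := t))) differentiable at (u i)" if "i < n" "u \<in> U" for i u
    using der[OF that] unfolding real_differentiable_def by (rule exI)
  moreover have "Ck_on k n U (\<lambda>u. deriv (\<lambda>t. f (u(i := t))) (u i))" if "i < n" for i
    by (rule Ck_on_cong[OF U _ Ck[OF that]]) (rule DERIV_imp_deriv[OF der[OF that], symmetric])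
  ultimately show ?thesis
    using U cont by (simp add: continuous_map_Euclidean_space)
qed

lemma Ck_on_SucE:
  assumes "Ck_on (Suc k) n U f"
  obtains g where
    "\<And>i u. i < n \<Longrightarrow> u \<in> U \<Longrightarrow> ((\<lambda>t. f (u(i := t))) has_real_derivative g i u) (at (u i))"
    "\<And>i. i < n \<Longrightarrow> Ck_on k n U (g i)"
proof
  show "Ck_on k n U (\<lambda>u. deriv (\<lambda>t. f (u(i := t))) (u i))" if "i < n" for i
    using assms that by simp
  show "((\<lambda>t. f (u(i := t))) has_real_derivative deriv (\<lambda>t. f (u(i := t))) (u i)) (at (u i))"
    if "i < n" "u \<in> U" for i u
    using assms that by (simp add: DERIV_deriv_iff_real_differentiable)
qed

lemma Ck_on_SucD: "Ck_on (Suc k) n U f \<Longrightarrow> Ck_on k n U f"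
  by (induction k arbitrary: f) auto

lemma Ck_on_subset: "Ck_on k n U f \<Longrightarrow> V \<subseteq> U \<Longrightarrow> Ck_on k n V f"
  by (induction k arbitrary: f) (auto intro: continuous_map_from_subtopology_mono)

lemma Ck_on_local:
  assumes U: "openin (Euclidean_space n) U"
    and loc: "\<And>u. u \<in> U \<Longrightarrow> \<exists>V. openin (Euclidean_space n) V \<and> u \<in> V \<and> V \<subseteq> U \<and> Ck_on k n V f"
  shows "Ck_on k n U f"
  using loc
proof (induction k arbitrary: f)
  case 0
  have "continuous_on U f"
    using 0 by (intro continuous_on_Euclidean_local[OF U]) (meson Ck_on_continuous_on)
  then show ?case
    using U by (simp add: continuous_map_Euclidean_space)
next
  case (Suc k)
  have "continuous_on U f"
    using Suc.prems by (intro continuous_on_Euclidean_local[OF U]) (meson Ck_on_continuous_on)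
  moreover have "(\<lambda>t. f (u(i := t))) differentiable at (u i)" if "u \<in> U" "i < n" for u i
    using Suc.prems[OF that(1)] that(2) by auto
  moreover have "Ck_on k n U (\<lambda>u. deriv (\<lambda>t. f (u(i := t))) (u i))" if "i < n" for i
  proof (rule Suc.IH)
    fix u assume "u \<in> U"
    then show "\<exists>V. openin (Euclidean_space n) V \<and> u \<in> V \<and> V \<subseteq> U \<and>
        Ck_on k n V (\<lambda>u. deriv (\<lambda>t. f (u(i := t))) (u i))"
      using Suc.prems[of u] that by auto
  qed
  ultimately show ?case
    using U by (simp add: continuous_map_Euclidean_space)
qed

lemma Ck_on_const:
  assumes "openin (Euclidean_space n) U"
  shows "Ck_on k n U (\<lambda>u. c)"
proof (induction k arbitrary: c)
  case 0
  then show ?case by simp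
next
  case (Suc k)
  show ?case
    by (rule Ck_on_SucI[OF assms, where g = "\<lambda>_ _. 0"]) (simp_all add: Suc)
qed

lemma Ck_on_coord:
  assumes U: "openin (Euclidean_space n) U"
  shows "Ck_on k n U (\<lambda>u. u j)"
proof -
  have cont: "continuous_on U (\<lambda>u. u j)"
    by (rule continuous_on_subset[OF continuous_on_product_coordinates subset_UNIV])
  show ?thesis
  proof (cases k)
    case 0
    then show ?thesis
      using cont U by (simp add: continuous_map_Euclidean_space)
  next
    case (Suc k')
    have der: "((\<lambda>t. (u(i := t)) j) has_real_derivative (if i = j then 1 else 0)) (at (u i))"
      for i and u :: "nat \<Rightarrow> real"
      by (cases "i = j") simp_all
    show ?thesis
      unfolding Suc by (rule Ck_on_SucI[OF U cont der Ck_on_const[OF U]])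
  qed
qed

lemma Ck_on_add:
  assumes U: "openin (Euclidean_space n) U" and "Ck_on k n U f" "Ck_on k n U g"
  shows "Ck_on k n U (\<lambda>u. f u + g u)"
  using assms(2,3)
proof (induction k arbitrary: f g)
  case 0
  then show ?case
    using U by (simp add: continuous_map_Euclidean_space continuous_on_add)
next
  case (Suc k)
  obtain f' where f':
    "\<And>i u. i < n \<Longrightarrow> u \<in> U \<Longrightarrow> ((\<lambda>t. f (u(i := t))) has_real_derivative f' i u) (at (u i))"
    "\<And>i. i < n \<Longrightarrow> Ck_on k n U (f' i)"
    using Ck_on_SucE[OF Suc.prems(1)] by metis
  obtain g' where g':
    "\<And>i u. i < n \<Longrightarrow> u \<in> U \<Longrightarrow> ((\<lambda>t. g (u(i := t))) has_real_derivative g' i u) (at (u i))"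
    "\<And>i. i < n \<Longrightarrow> Ck_on k n U (g' i)"
    using Ck_on_SucE[OF Suc.prems(2)] by metis
  show ?case
  proof (rule Ck_on_SucI[OF U])
    show "continuous_on U (\<lambda>u. f u + g u)"
      using Suc.prems by (intro continuous_on_add Ck_on_continuous_on[OF U])
    fix i assume i: "i < n"
    show "Ck_on k n U (\<lambda>u. f' i u + g' i u)"
      by (rule Suc.IH[OF f'(2)[OF i] g'(2)[OF i]])
    show "((\<lambda>t. f (u(i := t)) + g (u(i := t))) has_real_derivative f' i u + g' i u) (at (u i))"
      if "u \<in> U" for u
      by (rule DERIV_add[OF f'(1)[OF i that] g'(1)[OF i that]])
  qed
qed

lemma Ck_on_mult:
  assumes U: "openin (Euclidean_space n) U" and "Ck_on k n U f" "Ck_on k n U g"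
  shows "Ck_on k n U (\<lambda>u. f u * g u)"
  using assms(2,3)
proof (induction k arbitrary: f g)
  case 0
  then show ?case
    using U by (simp add: continuous_map_Euclidean_space continuous_on_mult)
next
  case (Suc k)
  obtain f' where f':
    "\<And>i u. i < n \<Longrightarrow> u \<in> U \<Longrightarrow> ((\<lambda>t. f (u(i := t))) has_real_derivative f' i u) (at (u i))"
    "\<And>i. i < n \<Longrightarrow> Ck_on k n U (f' i)"
    using Ck_on_SucE[OF Suc.prems(1)] by metis
  obtain g' where g':
    "\<And>i u. i < n \<Longrightarrow> u \<in> U \<Longrightarrow> ((\<lambda>t. g (u(i := t))) has_real_derivative g' i u) (at (u i))"
    "\<And>i. i < n \<Longrightarrow> Ck_on k n U (g' i)"
    using Ck_on_SucE[OF Suc.prems(2)] by metis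
  show ?case
  proof (rule Ck_on_SucI[OF U])
    show "continuous_on U (\<lambda>u. f u * g u)"
      using Suc.prems by (intro continuous_on_mult Ck_on_continuous_on[OF U])
    fix i assume i: "i < n"
    show "Ck_on k n U (\<lambda>u. f' i u * g u + g' i u * f u)"
      by (rule Ck_on_add[OF U Suc.IH[OF f'(2)[OF i] Ck_on_SucD[OF Suc.prems(2)]]
            Suc.IH[OF g'(2)[OF i] Ck_on_SucD[OF Suc.prems(1)]]])
    show "((\<lambda>t. f (u(i := t)) * g (u(i := t))) has_real_derivative f' i u * g u + g' i u * f u)
        (at (u i))" if "u \<in> U" for u
      using DERIV_mult[OF f'(1)[OF i that] g'(1)[OF i that]] by simp
  qed
qed

text \<open>
  The chain rule for an outer function of one variable, given together with all its derivatives as a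
  sequence \<open>D\<close>. The partial derivatives of \<open>D j \<circ> s\<close> involve \<open>D (Suc j)\<close>, so the induction needs the
  claim for all \<open>j\<close> at once.
\<close>
lemma Ck_on_compose:
  assumes U: "openin (Euclidean_space n) U"
    and D: "\<And>j x. x \<in> S \<Longrightarrow> (D j has_real_derivative D (Suc j) x) (at x)"
    and "Ck_on k n U s" and S: "s ` U \<subseteq> S"
  shows "Ck_on k n U (\<lambda>u. D j (s u))"
  using assms(3)
proof (induction k arbitrary: j)
  have contD: "continuous_on S (D j)" for j
    by (intro continuous_at_imp_continuous_on ballI DERIV_isCont[OF D])
  have cont: "continuous_on U (\<lambda>u. D j (s u))" if "continuous_on U s" for j
    by (rule continuous_on_compose2[OF contD that S])
  {
    case 0
    then show ?case
      using U cont by (simp add: continuous_map_Euclidean_space)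
  next
    case (Suc k)
    obtain s' where s':
      "\<And>i u. i < n \<Longrightarrow> u \<in> U \<Longrightarrow> ((\<lambda>t. s (u(i := t))) has_real_derivative s' i u) (at (u i))"
      "\<And>i. i < n \<Longrightarrow> Ck_on k n U (s' i)"
      using Ck_on_SucE[OF Suc.prems] by metis
    show ?case
    proof (rule Ck_on_SucI[OF U])
      show "continuous_on U (\<lambda>u. D j (s u))"
        by (rule cont[OF Ck_on_continuous_on[OF U Suc.prems]])
      fix i assume i: "i < n"
      show "Ck_on k n U (\<lambda>u. D (Suc j) (s u) * s' i u)"
        by (rule Ck_on_mult[OF U Suc.IH[OF Ck_on_SucD[OF Suc.prems]] s'(2)[OF i]])
      show "((\<lambda>t. D j (s (u(i := t)))) has_real_derivative D (Suc j) (s u) * s' i u) (at (u i))"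
        if "u \<in> U" for u
      proof (rule DERIV_chain2[where g = "\<lambda>t. s (u(i := t))" and f = "D j"])
        have "s u \<in> S"
          using S that by blast
        then show "(D j has_real_derivative D (Suc j) (s u)) (at (s (u(i := u i))))"
          using D by simp
      qed (rule s'(1)[OF i that])
    qed
  }
qed

text \<open>
  A partial derivative of \<open>1 / f\<close> is a product of two copies of \<open>1 / f\<close> and a partial derivative of
  \<open>f\<close>, so the induction hypothesis applies to it through the product rule.
\<close>
lemma Ck_on_inverse:
  assumes U: "openin (Euclidean_space n) U" and f: "Ck_on k n U f"
    and nz: "\<And>u. u \<in> U \<Longrightarrow> f u \<noteq> 0"
  shows "Ck_on k n U (\<lambda>u. inverse (f u))"
  using f
proof (induction k)
  case 0
  then show ?case
    using U nz by (simp add: continuous_map_Euclidean_space continuous_on_inverse)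
next
  case (Suc k)
  obtain f' where f':
    "\<And>i u. i < n \<Longrightarrow> u \<in> U \<Longrightarrow> ((\<lambda>t. f (u(i := t))) has_real_derivative f' i u) (at (u i))"
    "\<And>i. i < n \<Longrightarrow> Ck_on k n U (f' i)"
    using Ck_on_SucE[OF Suc.prems(1)] by metis
  have inv: "Ck_on k n U (\<lambda>u. inverse (f u))"
    by (rule Suc.IH[OF Ck_on_SucD[OF Suc.prems]])
  show ?case
  proof (rule Ck_on_SucI[OF U])
    show "continuous_on U (\<lambda>u. inverse (f u))"
      using Ck_on_continuous_on[OF U Suc.prems] nz by (simp add: continuous_on_inverse)
    fix i assume i: "i < n"
    show "Ck_on k n U (\<lambda>u. (- 1) * (inverse (f u) * f' i u * inverse (f u)))"
      by (rule Ck_on_mult[OF U Ck_on_const[OF U]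
            Ck_on_mult[OF U Ck_on_mult[OF U inv f'(2)[OF i]] inv]])
    show "((\<lambda>t. inverse (f (u(i := t)))) has_real_derivative
        (- 1) * (inverse (f u) * f' i u * inverse (f u))) (at (u i))" if "u \<in> U" for u
      using DERIV_inverse'[OF f'(1)[OF i that]] nz[OF that] by simp
  qed
qed

text \<open>
  Points of \<open>n\<close>-space are the points of \<open>m\<close>-space whose coordinates from \<open>n\<close> on are zero, and the first
  \<open>n\<close> partial derivatives are given by the same expressions in both spaces. This allows one to
  differentiate with respect to an additional variable and then to set that variable to zero.
\<close>
lemma Ck_on_slice:
  assumes "Ck_on k m W f" "n \<le> m" "V \<subseteq> W" "V \<subseteq> {x. \<forall>i\<ge>n. x i = 0}"
  shows "Ck_on k n V f"
  using assms(1)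
proof (induction k arbitrary: f)
  have cont: "continuous_map (subtopology (Euclidean_space n) V) euclideanreal f"
    if "continuous_map (subtopology (Euclidean_space m) W) euclideanreal f" for f
  proof -
    have "{x :: nat \<Rightarrow> real. \<forall>i\<ge>n. x i = 0} \<inter> V \<subseteq> {x. \<forall>i\<ge>m. x i = 0} \<inter> W"
      using assms by force
    then show ?thesis
      using that unfolding Euclidean_space_top_of_set subtopology_subtopology
      by (simp add: continuous_on_subset)
  qed
  {
    case 0
    then show ?case using cont by simp
  next
    case (Suc k)
    then show ?case using cont assms by auto
  }
qed

lemma smooth_real_continuous_on:
  assumes "openin (Euclidean_space n) U" "smooth_real n U f"
  shows "continuous_on U f"
  using assms Ck_on_continuous_on by (auto simp: smooth_real_def)

lemma smooth_real_cong:
  assumes "openin (Euclidean_space n) U" "\<And>u. u \<in> U \<Longrightarrow> f u = g u" "smooth_real n U f"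
  shows "smooth_real n U g"
  using Ck_on_cong[OF assms(1,2)] assms(3) by (simp add: smooth_real_def)

lemma smooth_real_local:
  assumes "openin (Euclidean_space n) U"
    and "\<And>u. u \<in> U \<Longrightarrow> \<exists>V. openin (Euclidean_space n) V \<and> u \<in> V \<and> V \<subseteq> U \<and> smooth_real n V f"
  shows "smooth_real n U f"
  unfolding smooth_real_def
proof
  fix k show "Ck_on k n U f"
    by (rule Ck_on_local[OF assms(1)]) (use assms(2) in \<open>meson smooth_real_def\<close>)
qed

lemma smooth_real_subset: "smooth_real n U f \<Longrightarrow> V \<subseteq> U \<Longrightarrow> smooth_real n V f"
  by (auto simp: smooth_real_def intro: Ck_on_subset)

lemma smooth_real_const: "openin (Euclidean_space n) U \<Longrightarrow> smooth_real n U (\<lambda>u. c)"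
  by (simp add: smooth_real_def Ck_on_const)

lemma smooth_real_coord: "openin (Euclidean_space n) U \<Longrightarrow> smooth_real n U (\<lambda>u. u j)"
  by (simp add: smooth_real_def Ck_on_coord)

lemma smooth_real_add:
  "openin (Euclidean_space n) U \<Longrightarrow> smooth_real n U f \<Longrightarrow> smooth_real n U g
    \<Longrightarrow> smooth_real n U (\<lambda>u. f u + g u)"
  by (simp add: smooth_real_def Ck_on_add)

lemma smooth_real_mult:
  "openin (Euclidean_space n) U \<Longrightarrow> smooth_real n U f \<Longrightarrow> smooth_real n U g
    \<Longrightarrow> smooth_real n U (\<lambda>u. f u * g u)"
  by (simp add: smooth_real_def Ck_on_mult)

lemma smooth_real_divide:
  assumes "openin (Euclidean_space n) U" "smooth_real n U f" "smooth_real n U g"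
    and "\<And>u. u \<in> U \<Longrightarrow> g u \<noteq> 0"
  shows "smooth_real n U (\<lambda>u. f u / g u)"
  using assms by (simp add: smooth_real_def divide_inverse Ck_on_mult Ck_on_inverse)

lemma smooth_real_sum:
  assumes "openin (Euclidean_space n) U" "finite A" "\<And>a. a \<in> A \<Longrightarrow> smooth_real n U (f a)"
  shows "smooth_real n U (\<lambda>u. \<Sum>a\<in>A. f a u)"
  using assms(2,3)
proof (induction A)
  case empty
  then show ?case
    using smooth_real_const[OF assms(1), of 0] by simp
next
  case (insert a A)
  then show ?case
    using smooth_real_add[OF assms(1), of "f a" "\<lambda>u. \<Sum>a\<in>A. f a u"] by simp
qed

lemma smooth_real_compose:
  assumes "openin (Euclidean_space n) U" "smooth_real n U s" "s ` U \<subseteq> S"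
    and "\<And>j x. x \<in> S \<Longrightarrow> (D j has_real_derivative D (Suc j) x) (at x)"
  shows "smooth_real n U (\<lambda>u. D 0 (s u))"
  unfolding smooth_real_def
proof
  fix k show "Ck_on k n U (\<lambda>u. D 0 (s u))"
    using Ck_on_compose[where D = D and S = S, OF assms(1,4)] assms(2,3) by (auto simp: smooth_real_def)
qed

lemma smooth_real_partial:
  assumes "smooth_real n U f" "i < n"
  shows "smooth_real n U (\<lambda>u. deriv (\<lambda>t. f (u(i := t))) (u i))"
  unfolding smooth_real_def
proof
  fix k
  have "Ck_on (Suc k) n U f"
    using assms(1) unfolding smooth_real_def by blast
  then show "Ck_on k n U (\<lambda>u. deriv (\<lambda>t. f (u(i := t))) (u i))"
    using assms(2) by simp
qed

lemma smooth_real_slice: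
  assumes "smooth_real m W f" "n \<le> m" "V \<subseteq> W" "V \<subseteq> {x. \<forall>i\<ge>n. x i = 0}"
  shows "smooth_real n V f"
  using assms by (auto simp: smooth_real_def intro: Ck_on_slice)

lemma smooth_euclidean_inner:
  assumes "openin (Euclidean_space n) U" "smooth_euclidean n U p"
  shows "smooth_real n U (\<lambda>u. p u \<bullet> v)"
proof -
  have "smooth_real n U (\<lambda>u. \<Sum>b\<in>Basis. (p u \<bullet> b) * (v \<bullet> b))"
    using assms by (intro smooth_real_sum smooth_real_mult smooth_real_const)
      (auto simp: smooth_euclidean_def)
  then show ?thesis
    by (simp add: euclidean_inner[symmetric])
qed

lemma smooth_euclidean_subset:
  "smooth_euclidean n U p \<Longrightarrow> V \<subseteq> U \<Longrightarrow> smooth_euclidean n V p"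
  by (auto simp: smooth_euclidean_def intro: smooth_real_subset)

lemma smooth_euclidean_continuous_on:
  assumes "openin (Euclidean_space n) U" "smooth_euclidean n U p"
  shows "continuous_on U p"
  using assms
  by (subst continuous_on_componentwise)
    (auto simp: smooth_euclidean_def intro: smooth_real_continuous_on)

section \<open>Hadamard's lemma in one variable\<close>

abbreviation line_point :: "real \<Rightarrow> nat \<Rightarrow> real" where
  "line_point t \<equiv> (\<lambda>_. 0)(0 := t)"

text \<open>
  Partial derivatives of a function on \<open>1\<close>-space are ordinary derivatives, to which one-variable
  calculus applies.
\<close>
lemma smooth_real_line_iterated_deriv:
  assumes "smooth_real 1 W f" "line_point t \<in> W"
  shows "((deriv ^^ j) (\<lambda>t. f (line_point t)) has_real_derivative
           (deriv ^^ Suc j) (\<lambda>t. f (line_point t)) t) (at t)"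
proof -
  have "smooth_real 1 W g \<Longrightarrow> (deriv ^^ j) (\<lambda>t. g (line_point t)) differentiable at t" for g
  proof (induction j arbitrary: g)
    case 0
    then have "Ck_on (Suc 0) 1 W g"
      unfolding smooth_real_def by blast
    then have "\<forall>u\<in>W. (\<lambda>s. g (u(0 := s))) differentiable at (u 0)"
      by simp
    from bspec[OF this assms(2)] show ?case
      by (simp only: fun_upd_upd fun_upd_same funpow.simps id_apply)
  next
    case (Suc j)
    show ?case
      using Suc.IH[OF smooth_real_partial[OF Suc.prems, of 0]]
      by (simp only: fun_upd_upd fun_upd_same funpow_Suc_right o_apply zero_less_one)
  qed
  from this[OF assms(1)] show ?thesis
    by (simp add: DERIV_deriv_iff_real_differentiable)
qed

text \<open>
  If a smooth function vanishes at \<open>0\<close>, its quotient by the variable \<open>t\<close> extends smoothly: the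
  fundamental theorem of calculus gives $D_0(t) - D_0(0) = t \int_0^1 D_1(st)\,ds$, and differentiating under the integral sign shows that the
  \<open>j\<close>-th derivative of the integral is $E_j(t) = \int_0^1 s^j D_{j+1}(st)\,ds$.
\<close>
lemma hadamard_quotient:
  fixes D :: "nat \<Rightarrow> real \<Rightarrow> real"
  assumes D: "\<And>j t. t \<in> {-e<..<e} \<Longrightarrow> (D j has_real_derivative D (Suc j) t) (at t)"
    and e: "e > 0"
  obtains E where
    "\<And>j t. t \<in> {-e<..<e} \<Longrightarrow> (E j has_real_derivative E (Suc j) t) (at t)"
    "\<And>t. t \<in> {-e<..<e} \<Longrightarrow> D 0 t = D 0 0 + t * E 0 t"
    "E 0 0 = D 1 0"
proof
  define E where "E = (\<lambda>j t. integral {0..1} (\<lambda>s. s ^ j * D (Suc j) (s * t)))"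
  \<comment> \<open>The integrals evaluate \<open>D\<close> along the segment from \<open>0\<close> to \<open>t\<close>, which stays in the interval.\<close>
  have scale: "s * t \<in> {-e<..<e}" if "t \<in> {-e<..<e}" "s \<in> {0..1}" for s t
  proof -
    have "\<bar>s * t\<bar> \<le> 1 * \<bar>t\<bar>"
      using that unfolding abs_mult by (intro mult_right_mono) auto
    then show ?thesis
      using that by auto
  qed
  have contD: "continuous_on {-e<..<e} (D k)" for k
    by (intro continuous_at_imp_continuous_on ballI DERIV_isCont[OF D])
  have cont: "continuous_on {0..1} (\<lambda>s. D k (s * t))" if "t \<in> {-e<..<e}" for k t
  proof (rule continuous_on_compose2[OF contD])
    show "(\<lambda>s. s * t) ` {0..1} \<subseteq> {-e<..<e}"
      using scale[OF that] by blast
  qed (intro continuous_intros)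
  show "(E j has_real_derivative E (Suc j) t) (at t)" if t: "t \<in> {-e<..<e}" for j t
  proof -
    have "((\<lambda>x. integral (cbox 0 1) (\<lambda>s. s ^ j * D (Suc j) (s * x))) has_field_derivative
        integral (cbox 0 1) (\<lambda>s. s ^ Suc j * D (Suc (Suc j)) (s * t))) (at t within {-e<..<e})"
    proof (rule leibniz_rule_field_derivative)
      fix x s :: real assume x: "x \<in> {-e<..<e}" and s: "s \<in> cbox 0 1"
      have "(D (Suc j) has_real_derivative D (Suc (Suc j)) (s * x)) (at (s * x))"
        using scale[of x s] x s by (intro D) auto
      moreover have "((\<lambda>x. s * x) has_real_derivative s) (at x)"
        by (auto intro!: derivative_eq_intros)
      ultimately have "((\<lambda>x. D (Suc j) (s * x)) has_real_derivative D (Suc (Suc j)) (s * x) * s) (at x)"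
        by (rule DERIV_chain2)
      from DERIV_cmult[OF this, of "s ^ j"]
      show "((\<lambda>x. s ^ j * D (Suc j) (s * x)) has_field_derivative
          s ^ Suc j * D (Suc (Suc j)) (s * x)) (at x within {-e<..<e})"
        by (simp add: mult_ac has_field_derivative_at_within)
    next
      fix x assume "x \<in> {-e<..<e}"
      then show "(\<lambda>s. s ^ j * D (Suc j) (s * x)) integrable_on cbox 0 1"
        using cont[of x "Suc j"] unfolding cbox_interval
        by (intro integrable_continuous_real continuous_intros)
    next
      have "continuous_on ({-e<..<e} \<times> {0..1}) (\<lambda>z. D (Suc (Suc j)) (snd z * fst z))"
      proof (rule continuous_on_compose2[OF contD])
        show "(\<lambda>z. snd z * fst z) ` ({-e<..<e} \<times> {0..1}) \<subseteq> {-e<..<e}"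
          using scale by force
      qed (intro continuous_intros)
      then show "continuous_on ({-e<..<e} \<times> cbox 0 1) (\<lambda>(x, s). s ^ Suc j * D (Suc (Suc j)) (s * x))"
        unfolding split_beta cbox_interval by (intro continuous_intros)
    qed (use t in simp_all)
    then show ?thesis
      unfolding at_within_open[OF t open_greaterThanLessThan] E_def cbox_interval .
  qed
  show "D 0 t = D 0 0 + t * E 0 t" if t: "t \<in> {-e<..<e}" for t
  proof -
    \<comment> \<open>The integrand is the derivative of \<open>s \<mapsto> D 0 (s * t)\<close>.\<close>
    have "((\<lambda>s. t * D 1 (s * t)) has_integral D 0 (1 * t) - D 0 (0 * t)) {0..1}"
    proof (rule fundamental_theorem_of_calculus)
      fix s :: real assume s: "s \<in> {0..1}"
      have "(D 0 has_real_derivative D (Suc 0) (s * t)) (at (s * t))"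
        using scale[OF t s] by (rule D)
      moreover have "((\<lambda>s. s * t) has_real_derivative t) (at s)"
        by (auto intro!: derivative_eq_intros)
      ultimately have "((\<lambda>s. D 0 (s * t)) has_real_derivative D (Suc 0) (s * t) * t) (at s)"
        by (rule DERIV_chain2)
      then show "((\<lambda>s. D 0 (s * t)) has_vector_derivative t * D 1 (s * t)) (at s within {0..1})"
        by (simp add: has_real_derivative_iff_has_vector_derivative[symmetric] mult.commute
            has_field_derivative_at_within)
    qed simp
    then have "integral {0..1} (\<lambda>s. t * D 1 (s * t)) = D 0 (1 * t) - D 0 (0 * t)"
      by (rule integral_unique)
    then show ?thesis
      by (simp add: E_def)
  qed
  show "E 0 0 = D 1 0"
    by (simp add: E_def)
qed

section \<open>Germs of smooth functions and their vanishing ideal\<close>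

lemma smooth_euclidean_real: "smooth_euclidean n U f \<longleftrightarrow> smooth_real n U f" for f :: "_ \<Rightarrow> real"
  by (simp add: smooth_euclidean_def)

lemma D_nbhds_Int: "B \<in> D_nbhds X x \<Longrightarrow> C \<in> D_nbhds X x \<Longrightarrow> B \<inter> C \<in> D_nbhds X x"
  by (auto simp: D_nbhds_def intro: openin_Int)

text \<open>
  Operations on germs are defined as unions over all representatives of the arguments; such a union is a
  single class because all its members coincide.
\<close>
lemma UN_pairs_constant:
  assumes "r \<in> S" "\<And>C G. (C, G) \<in> S \<Longrightarrow> f C G = T"
  shows "(\<Union>(C, G)\<in>S. f C G) = T"
proof -
  have "(case s of (C, G) \<Rightarrow> f C G) = T" if "s \<in> S" for s
    using assms(2)[of "fst s" "snd s"] that by (simp add: case_prod_beta)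
  then show ?thesis
    using assms(1) by auto
qed

locale germs_at =
  fixes X :: "'a diff_space" and x :: 'a
  assumes plots_parametrizations: "plots X \<subseteq> parametrizations (points X)"
begin

abbreviation "reps \<equiv> points (germ_reps X x)"
abbreviation "cls \<equiv> germ_class X x"
abbreviation "germs \<equiv> germ_algebra X x"
abbreviation "vanishing \<equiv> vanishing_ideal X x"

lemma openin_plot_domain: "(n, U, p) \<in> plots X \<Longrightarrow> openin (Euclidean_space n) U"
  using plots_parametrizations by (auto simp: parametrizations_def)

lemma germ_reps_iff:
  "(B, F) \<in> reps \<longleftrightarrow> B \<in> D_nbhds X x \<and> F \<in> extensional B \<and>
     (\<forall>n U p. (n, U, p) \<in> plots X \<and> p ` U \<subseteq> B \<longrightarrow> smooth_real n U (\<lambda>u. F (p u)))"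
proof -
  have "(n, U, F \<circ> p) \<in> plots diff_real \<longleftrightarrow> smooth_real n U (\<lambda>u. F (p u))"
    if "(n, U, p) \<in> plots X" for n U p
    using openin_plot_domain[OF that]
    by (simp add: diff_euclidean_def parametrizations_def smooth_euclidean_real comp_def)
  then show ?thesis
    unfolding germ_reps_def diff_coprod_def diff_fun_def smooth_maps_def diff_smooth_def
    by (auto simp: diff_sub_def diff_euclidean_def PiE_def)
qed

lemma equiv_germ_rel: "equiv reps (germ_rel X x)"
proof (rule equivI)
  show "germ_rel X x \<subseteq> reps \<times> reps"
    by (auto simp: germ_rel_def)
  show "refl_on reps (germ_rel X x)"
  proof (rule refl_onI)
    fix r assume r: "r \<in> reps"
    obtain B F where BF: "r = (B, F)"
      by (cases r)
    then have "B \<in> D_nbhds X x"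
      using r by (simp add: germ_reps_iff)
    then show "(r, r) \<in> germ_rel X x"
      using r unfolding BF germ_rel_def by auto
  qed
  show "sym (germ_rel X x)"
  proof (rule symI)
    fix r s assume "(r, s) \<in> germ_rel X x"
    then obtain B F B' F' C where "r = (B, F)" "s = (B', F')" "(B, F) \<in> reps" "(B', F') \<in> reps"
      "C \<in> D_nbhds X x" "C \<subseteq> B \<inter> B'" "\<forall>y\<in>C. F y = F' y"
      unfolding germ_rel_def by blast
    then show "(s, r) \<in> germ_rel X x"
      unfolding germ_rel_def by (simp add: bexI[of _ C])
  qed
  show "trans (germ_rel X x)"
  proof (rule transI)
    fix r s t assume rs: "(r, s) \<in> germ_rel X x" and st: "(s, t) \<in> germ_rel X x"
    obtain B F B' F' B'' F'' where r: "r = (B, F)" "s = (B', F')" "t = (B'', F'')"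
      by (cases r, cases s, cases t)
    obtain C where C: "C \<in> D_nbhds X x" "C \<subseteq> B \<inter> B'" "\<forall>y\<in>C. F y = F' y"
      using rs by (auto simp: germ_rel_def r)
    obtain C' where C': "C' \<in> D_nbhds X x" "C' \<subseteq> B' \<inter> B''" "\<forall>y\<in>C'. F' y = F'' y"
      using st by (auto simp: germ_rel_def r)
    have "C \<inter> C' \<in> D_nbhds X x \<and> C \<inter> C' \<subseteq> B \<inter> B'' \<and> (\<forall>y\<in>C \<inter> C'. F y = F'' y)"
      using C C' by (auto intro: D_nbhds_Int)
    then have "\<exists>C\<in>D_nbhds X x. C \<subseteq> B \<inter> B'' \<and> (\<forall>y\<in>C. F y = F'' y)"
      by blast
    with rs st show "(r, t) \<in> germ_rel X x"
      by (simp add: germ_rel_def r)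
  qed
qed

lemma germ_class_eqI:
  assumes "(B, F) \<in> reps" "(B', F') \<in> reps" "C \<in> D_nbhds X x" "C \<subseteq> B \<inter> B'"
    and "\<And>y. y \<in> C \<Longrightarrow> F y = F' y"
  shows "cls (B, F) = cls (B', F')"
  unfolding germ_class_def
  by (rule equiv_class_eq[OF equiv_germ_rel]) (use assms in \<open>auto simp: germ_rel_def\<close>)

lemma mem_germ_class: "r \<in> reps \<Longrightarrow> r \<in> cls r"
  unfolding germ_class_def by (rule equiv_class_self[OF equiv_germ_rel])

lemma germ_classE:
  assumes "(C, G) \<in> cls (B, F)"
  obtains D where "(C, G) \<in> reps" "(B, F) \<in> reps" "D \<in> D_nbhds X x" "D \<subseteq> B \<inter> C"
    "\<forall>y\<in>D. F y = G y"
  using assms by (auto simp: germ_class_def germ_rel_def)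

lemma carrier_germ_algebra: "carrier germs = cls ` reps"
  by (auto simp: germ_algebra_def germ_class_def quotient_def)

lemma germ_pointwise_unary:
  assumes h: "\<And>n U f. openin (Euclidean_space n) U \<Longrightarrow> smooth_real n U f
                \<Longrightarrow> smooth_real n U (\<lambda>u. h (f u))"
    and r: "(B, F) \<in> reps"
  shows "(B, \<lambda>y\<in>B. h (F y)) \<in> reps"
    and "(\<Union>(C, G)\<in>cls (B, F). cls (C, \<lambda>y\<in>C. h (G y))) = cls (B, \<lambda>y\<in>B. h (F y))"
proof -
  have rep: "(B, \<lambda>y\<in>B. h (F y)) \<in> reps" if "(B, F) \<in> reps" for B F
    unfolding germ_reps_iff
  proof (intro conjI allI impI)
    fix n U p assume p: "(n, U, p) \<in> plots X \<and> p ` U \<subseteq> B"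
    then have U: "openin (Euclidean_space n) U"
      using openin_plot_domain by blast
    have "smooth_real n U (\<lambda>u. F (p u))"
      using p that by (simp add: germ_reps_iff)
    then have "smooth_real n U (\<lambda>u. h (F (p u)))"
      by (rule h[OF U])
    then show "smooth_real n U (\<lambda>u. (\<lambda>y\<in>B. h (F y)) (p u))"
      by (rule smooth_real_cong[OF U, rotated]) (use p in auto)
  qed (use that in \<open>auto simp: germ_reps_iff\<close>)
  show "(B, \<lambda>y\<in>B. h (F y)) \<in> reps"
    by (rule rep[OF r])
  have "cls (C, \<lambda>y\<in>C. h (G y)) = cls (B, \<lambda>y\<in>B. h (F y))" if CG: "(C, G) \<in> cls (B, F)" for C G
  proof -
    obtain D where "(C, G) \<in> reps" "(B, F) \<in> reps" "D \<in> D_nbhds X x" "D \<subseteq> B \<inter> C"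
      "\<forall>y\<in>D. F y = G y"
      by (rule germ_classE[OF CG])
    then show ?thesis
      by (intro germ_class_eqI[where C = D]) (auto simp: rep)
  qed
  with mem_germ_class[OF r]
  show "(\<Union>(C, G)\<in>cls (B, F). cls (C, \<lambda>y\<in>C. h (G y))) = cls (B, \<lambda>y\<in>B. h (F y))"
    by (rule UN_pairs_constant)
qed

text \<open>
  Addition and multiplication of germs are treated together: \<open>h\<close> is any operation on real numbers under
  which smooth functions are closed.
\<close>
lemma germ_pointwise_binary:
  assumes h: "\<And>n U f g. openin (Euclidean_space n) U \<Longrightarrow> smooth_real n U f \<Longrightarrow> smooth_real n U g
                \<Longrightarrow> smooth_real n U (\<lambda>u. h (f u) (g u))"
    and r: "(B, F) \<in> reps" "(B', F') \<in> reps"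
  shows "(B \<inter> B', \<lambda>y\<in>B \<inter> B'. h (F y) (F' y)) \<in> reps"
    and "(\<Union>(C, G)\<in>cls (B, F). \<Union>(C', G')\<in>cls (B', F'). cls (C \<inter> C', \<lambda>y\<in>C \<inter> C'. h (G y) (G' y)))
           = cls (B \<inter> B', \<lambda>y\<in>B \<inter> B'. h (F y) (F' y))"
proof -
  have rep: "(B \<inter> B', \<lambda>y\<in>B \<inter> B'. h (F y) (F' y)) \<in> reps"
    if "(B, F) \<in> reps" "(B', F') \<in> reps" for B F B' F'
    unfolding germ_reps_iff
  proof (intro conjI allI impI)
    fix n U p assume p: "(n, U, p) \<in> plots X \<and> p ` U \<subseteq> B \<inter> B'"
    then have U: "openin (Euclidean_space n) U"
      using openin_plot_domain by blast
    have "smooth_real n U (\<lambda>u. F (p u))" "smooth_real n U (\<lambda>u. F' (p u))"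
      using p that by (simp_all add: germ_reps_iff)
    then have "smooth_real n U (\<lambda>u. h (F (p u)) (F' (p u)))"
      by (rule h[OF U])
    then show "smooth_real n U (\<lambda>u. (\<lambda>y\<in>B \<inter> B'. h (F y) (F' y)) (p u))"
      by (rule smooth_real_cong[OF U, rotated]) (use p in auto)
  qed (use that in \<open>simp_all add: germ_reps_iff D_nbhds_Int\<close>)
  show "(B \<inter> B', \<lambda>y\<in>B \<inter> B'. h (F y) (F' y)) \<in> reps"
    by (rule rep[OF r])
  have pair: "cls (C \<inter> C', \<lambda>y\<in>C \<inter> C'. h (G y) (G' y)) = cls (B \<inter> B', \<lambda>y\<in>B \<inter> B'. h (F y) (F' y))"
    if CG: "(C, G) \<in> cls (B, F)" and CG': "(C', G') \<in> cls (B', F')" for C G C' G'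
  proof -
    obtain D where D: "(C, G) \<in> reps" "(B, F) \<in> reps" "D \<in> D_nbhds X x" "D \<subseteq> B \<inter> C"
      "\<forall>y\<in>D. F y = G y"
      by (rule germ_classE[OF CG])
    obtain D' where D': "(C', G') \<in> reps" "(B', F') \<in> reps" "D' \<in> D_nbhds X x" "D' \<subseteq> B' \<inter> C'"
      "\<forall>y\<in>D'. F' y = G' y"
      by (rule germ_classE[OF CG'])
    show ?thesis
      by (rule germ_class_eqI[OF rep[OF D(1) D'(1)] rep[OF r] D_nbhds_Int[OF D(3) D'(3)]])
        (use D(4,5) D'(4,5) in auto)
  qed
  have inner: "(\<Union>(C', G')\<in>cls (B', F'). cls (C \<inter> C', \<lambda>y\<in>C \<inter> C'. h (G y) (G' y)))
      = cls (B \<inter> B', \<lambda>y\<in>B \<inter> B'. h (F y) (F' y))" if "(C, G) \<in> cls (B, F)" for C G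
    by (rule UN_pairs_constant[OF mem_germ_class[OF r(2)] pair[OF that]])
  show "(\<Union>(C, G)\<in>cls (B, F). \<Union>(C', G')\<in>cls (B', F'). cls (C \<inter> C', \<lambda>y\<in>C \<inter> C'. h (G y) (G' y)))
      = cls (B \<inter> B', \<lambda>y\<in>B \<inter> B'. h (F y) (F' y))"
    by (rule UN_pairs_constant[OF mem_germ_class[OF r(1)] inner])
qed

lemma germ_add:
  assumes "(B, F) \<in> reps" "(B', F') \<in> reps"
  shows "(B \<inter> B', \<lambda>y\<in>B \<inter> B'. F y + F' y) \<in> reps"
    and "cls (B, F) \<oplus>\<^bsub>germs\<^esub> cls (B', F') = cls (B \<inter> B', \<lambda>y\<in>B \<inter> B'. F y + F' y)"
  using germ_pointwise_binary[OF smooth_real_add assms] by (simp_all add: germ_algebra_def)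

lemma germ_mult:
  assumes "(B, F) \<in> reps" "(B', F') \<in> reps"
  shows "(B \<inter> B', \<lambda>y\<in>B \<inter> B'. F y * F' y) \<in> reps"
    and "cls (B, F) \<otimes>\<^bsub>germs\<^esub> cls (B', F') = cls (B \<inter> B', \<lambda>y\<in>B \<inter> B'. F y * F' y)"
  using germ_pointwise_binary[OF smooth_real_mult assms] by (simp_all add: germ_algebra_def)

lemma germ_smult:
  assumes "(B, F) \<in> reps"
  shows "(B, \<lambda>y\<in>B. a * F y) \<in> reps"
    and "a \<odot>\<^bsub>germs\<^esub> cls (B, F) = cls (B, \<lambda>y\<in>B. a * F y)"
proof -
  have h: "smooth_real n U (\<lambda>u. a * f u)"
    if "openin (Euclidean_space n) U" "smooth_real n U f" for n U f
    using that by (intro smooth_real_mult smooth_real_const)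
  show "(B, \<lambda>y\<in>B. a * F y) \<in> reps" "a \<odot>\<^bsub>germs\<^esub> cls (B, F) = cls (B, \<lambda>y\<in>B. a * F y)"
    using germ_pointwise_unary[where h = "\<lambda>y. a * y", OF h assms] by (simp_all add: germ_algebra_def)
qed

lemma germ_class_in_vanishing_ideal:
  assumes "(B, F) \<in> reps"
  shows "cls (B, F) \<in> vanishing \<longleftrightarrow> F x = 0"
proof -
  have "G x = F x" if "(C, G) \<in> cls (B, F)" for C G
    by (rule germ_classE[OF that]) (auto simp: D_nbhds_def)
  then have "(\<forall>(C, G)\<in>cls (B, F). G x = 0) \<longleftrightarrow> F x = 0"
    using mem_germ_class[OF assms] by (metis (mono_tags, lifting) case_prodI2 case_prodD)
  moreover have "cls (B, F) \<in> carrier germs"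
    unfolding carrier_germ_algebra using assms by (rule imageI)
  ultimately show ?thesis
    by (simp add: vanishing_ideal_def)
qed

lemma vanishing_idealE:
  assumes "f \<in> vanishing"
  obtains B F where "(B, F) \<in> reps" "f = cls (B, F)" "F x = 0"
proof -
  obtain r where r: "r \<in> reps" "f = cls r"
    using assms unfolding vanishing_ideal_def carrier_germ_algebra by blast
  obtain B F where BF: "r = (B, F)"
    by (cases r)
  show ?thesis
  proof (rule that)
    show "(B, F) \<in> reps" "f = cls (B, F)"
      using r by (simp_all add: BF)
    then show "F x = 0"
      using assms germ_class_in_vanishing_ideal by simp
  qed
qed

lemma base_in_rep: "(B, F) \<in> reps \<Longrightarrow> x \<in> B"
  by (simp add: germ_reps_iff D_nbhds_def)

lemma vanishing_ideal_add: "f \<in> vanishing \<Longrightarrow> g \<in> vanishing \<Longrightarrow> f \<oplus>\<^bsub>germs\<^esub> g \<in> vanishing"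
  by (elim vanishing_idealE)
    (simp add: germ_add germ_class_in_vanishing_ideal base_in_rep)

lemma vanishing_ideal_mult: "f \<in> vanishing \<Longrightarrow> g \<in> vanishing \<Longrightarrow> f \<otimes>\<^bsub>germs\<^esub> g \<in> vanishing"
  by (elim vanishing_idealE)
    (simp add: germ_mult germ_class_in_vanishing_ideal base_in_rep)

lemma vanishing_ideal_smult: "f \<in> vanishing \<Longrightarrow> a \<odot>\<^bsub>germs\<^esub> f \<in> vanishing"
  by (elim vanishing_idealE)
    (simp add: germ_smult germ_class_in_vanishing_ideal base_in_rep)

text \<open>
  The instance of the group laws that moves elements from one coset of the kernel to another.
\<close>
lemma germ_add_diff_cancel:
  assumes "z \<in> vanishing" "f \<in> vanishing" "g \<in> vanishing"
  shows "(z \<oplus>\<^bsub>germs\<^esub> (f \<oplus>\<^bsub>germs\<^esub> ((- 1) \<odot>\<^bsub>germs\<^esub> g))) \<oplus>\<^bsub>germs\<^esub> g = z \<oplus>\<^bsub>germs\<^esub> f"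
proof -
  obtain Bz Z Bf F Bg G where r: "(Bz, Z) \<in> reps" "z = cls (Bz, Z)" "(Bf, F) \<in> reps" "f = cls (Bf, F)"
    "(Bg, G) \<in> reps" "g = cls (Bg, G)"
    using vanishing_idealE[OF assms(1)] vanishing_idealE[OF assms(2)] vanishing_idealE[OF assms(3)]
    by metis
  note s = germ_smult[OF r(5), of "- 1"]
  note fg = germ_add[OF r(3) s(1)]
  note zfg = germ_add[OF r(1) fg(1)]
  note lhs = germ_add[OF zfg(1) r(5)]
  note rhs = germ_add[OF r(1) r(3)]
  show ?thesis
    unfolding r s fg zfg lhs rhs
    by (rule germ_class_eqI[OF lhs(1) rhs(1), where C = "Bz \<inter> Bf \<inter> Bg"])
      (use r(1,3,5) in \<open>auto simp: germ_reps_iff intro: D_nbhds_Int\<close>)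
qed

end

section \<open>Lines through the origin of the pencil\<close>

interpretation pencil: germs_at pencil 0
  by unfold_locales (auto simp: pencil_def)

text \<open>
  With a unit vector \<open>v\<close> the coordinate of a point \<open>x\<close> of the line is \<open>x \<bullet> v\<close>, which is defined and smooth on
  the whole plane.
\<close>
lemma RP1_obtain_direction:
  assumes "L \<in> RP1"
  obtains v where "norm v = 1" "L = range (\<lambda>t. t *\<^sub>R v)"
proof -
  have L: "subspace L" "dim L = 1"
    using assms by (auto simp: RP1_def)
  obtain S where S: "S \<subseteq> L" "independent S" "L \<subseteq> span S" "card S = dim L"
    using basis_exists by blast
  then obtain b where b: "S = {b}"
    using L by (metis card_1_singletonE)
  have "b \<noteq> 0"
    using S(2) b dependent_zero by blast
  have "L = span {b}"
    using S L b by (metis span_minimal subset_antisym)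
  have "range (\<lambda>t. t *\<^sub>R b) = range (\<lambda>t. t *\<^sub>R (b /\<^sub>R norm b))"
  proof (intro subset_antisym image_subsetI)
    fix t show "t *\<^sub>R b \<in> range (\<lambda>t. t *\<^sub>R (b /\<^sub>R norm b))"
      using \<open>b \<noteq> 0\<close> by (intro image_eqI[of _ _ "t * norm b"]) auto
    show "t *\<^sub>R (b /\<^sub>R norm b) \<in> range (\<lambda>t. t *\<^sub>R b)"
      by (intro image_eqI[of _ _ "t / norm b"]) (auto simp: divide_inverse)
  qed
  then have "L = range (\<lambda>t. t *\<^sub>R (b /\<^sub>R norm b))"
    using \<open>L = span {b}\<close> by (simp add: span_singleton)
  moreover have "norm (b /\<^sub>R norm b) = 1"
    using \<open>b \<noteq> 0\<close> by simp
  ultimately show ?thesis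
    using that by blast
qed

lemma line_in_RP1: "v \<noteq> 0 \<Longrightarrow> range (\<lambda>t. t *\<^sub>R v) \<in> RP1"
  using subspace_span[of "{v}"] dim_span[of "{v}"] by (simp add: RP1_def span_singleton)

lemma on_line_inner: "norm v = 1 \<Longrightarrow> x \<in> range (\<lambda>t. t *\<^sub>R v) \<Longrightarrow> x = (x \<bullet> v) *\<^sub>R v"
  by (auto simp: norm_eq_1)

lemma zero_in_RP1: "L \<in> RP1 \<Longrightarrow> 0 \<in> L"
  by (auto simp: RP1_def subspace_0)

text \<open>
  These plots give access to the values of a smooth function on a line, including the
  origin.
\<close>
lemma pencil_line_plot:
  assumes U: "openin (Euclidean_space n) U" and s: "smooth_real n U s" and v: "v \<noteq> 0"
  shows "(n, U, \<lambda>u. s u *\<^sub>R v) \<in> plots pencil"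
proof -
  have "smooth_euclidean n U (\<lambda>u. s u *\<^sub>R v)"
    using U s unfolding smooth_euclidean_def inner_scaleR_left
    by (intro ballI smooth_real_mult smooth_real_const)
  moreover have "(\<lambda>u. s u *\<^sub>R v) ` U \<subseteq> range (\<lambda>t. t *\<^sub>R v)"
    by blast
  ultimately show ?thesis
    using U line_in_RP1[OF v] by (auto simp: pencil_def parametrizations_def)
qed

lemma D_nbhd_line_domain:
  assumes U: "openin (Euclidean_space n) U" and s: "smooth_real n U s" and v: "v \<noteq> 0"
    and B: "B \<in> D_nbhds pencil 0"
  shows "openin (Euclidean_space n) {u \<in> U. s u *\<^sub>R v \<in> B}"
  using B pencil_line_plot[OF U s v] by (auto simp: D_nbhds_def openin_D_topology)

lemma openin_Euclidean_whole: "openin (Euclidean_space n) {u. \<forall>i\<ge>n. u i = 0}"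
  by (auto simp: openin_Euclidean_space)

text \<open>
  The plot \<open>t \<mapsto> t *\<^sub>R v\<close>, restricted to the preimage of \<open>B\<close>, turns smoothness on the pencil into
  smoothness of one-variable functions.
\<close>
lemma rep_iterated_derivs:
  assumes rep: "(B, F) \<in> pencil.reps" and v: "v \<noteq> 0"
  obtains e where "e > 0"
    "\<forall>t\<in>{-e<..<e}. t *\<^sub>R v \<in> B"
    "\<forall>j. \<forall>t\<in>{-e<..<e}.
      ((deriv ^^ j) (\<lambda>t. F (t *\<^sub>R v)) has_real_derivative (deriv ^^ Suc j) (\<lambda>t. F (t *\<^sub>R v)) t) (at t)"
proof -
  let ?S = "{u :: nat \<Rightarrow> real. \<forall>i\<ge>1. u i = 0}"
  define W where "W = {u \<in> ?S. u 0 *\<^sub>R v \<in> B}"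
  have B: "B \<in> D_nbhds pencil 0"
    using rep by (simp add: pencil.germ_reps_iff)
  have W: "openin (Euclidean_space 1) W"
    unfolding W_def
    by (intro D_nbhd_line_domain openin_Euclidean_whole smooth_real_coord v B)
  have "(1, W, \<lambda>u. u 0 *\<^sub>R v) \<in> plots pencil"
    by (intro pencil_line_plot W smooth_real_coord v)
  moreover have "(\<lambda>u. u 0 *\<^sub>R v) ` W \<subseteq> B"
    by (auto simp: W_def)
  ultimately have sm: "smooth_real 1 W (\<lambda>u. F (u 0 *\<^sub>R v))"
    using rep by (simp add: pencil.germ_reps_iff)
  have "(\<lambda>_. 0) \<in> W"
    using pencil.base_in_rep[OF rep] by (simp add: W_def)
  then have "\<forall>\<^sub>F t in nhds 0. line_point t \<in> W"
    using eventually_coordinate_line_in_open[OF W, of "\<lambda>_. 0" 0] by simp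
  then obtain e where e: "e > 0" "\<And>t. dist t 0 < e \<Longrightarrow> line_point t \<in> W"
    unfolding eventually_nhds_metric by blast
  have in_W: "line_point t \<in> W" if "t \<in> {-e<..<e}" for t
    using that by (intro e(2)) (auto simp: dist_real_def)
  have inB: "t *\<^sub>R v \<in> B" if "t \<in> {-e<..<e}" for t
    using in_W[OF that] unfolding W_def by simp
  have der: "((deriv ^^ j) (\<lambda>t. F (t *\<^sub>R v)) has_real_derivative (deriv ^^ Suc j) (\<lambda>t. F (t *\<^sub>R v)) t) (at t)"
    if "t \<in> {-e<..<e}" for j t
    using smooth_real_line_iterated_deriv[OF sm in_W[OF that], of j]
    unfolding fun_upd_same .
  show ?thesis
    by (rule that[OF e(1)]) (use inB der in blast)+
qed

text \<open>
  The zero function represents a germ on every neighbourhood, so the segment can be read off from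
  the previous lemma.
\<close>
lemma D_nbhd_contains_line_segment:
  assumes B: "B \<in> D_nbhds pencil 0" and L: "L \<in> RP1"
  obtains e where "e > 0" "\<forall>x\<in>L. norm x < e \<longrightarrow> x \<in> B"
proof -
  obtain v where v: "norm v = 1" "L = range (\<lambda>t. t *\<^sub>R v)"
    using RP1_obtain_direction[OF L] .
  have "(B, \<lambda>x\<in>B. 0) \<in> pencil.reps"
    unfolding pencil.germ_reps_iff
  proof (intro conjI allI impI B)
    fix n U p assume p: "(n, U, p) \<in> plots pencil \<and> p ` U \<subseteq> B"
    then have U: "openin (Euclidean_space n) U"
      using pencil.openin_plot_domain by blast
    show "smooth_real n U (\<lambda>u. (\<lambda>x\<in>B. 0) (p u))"
      by (rule smooth_real_cong[OF U _ smooth_real_const[OF U, of 0]]) (use p in auto)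
  qed auto
  moreover have "v \<noteq> 0"
    using v by auto
  ultimately obtain e where e: "e > 0" "\<forall>t\<in>{-e<..<e}. t *\<^sub>R v \<in> B"
    by (rule rep_iterated_derivs)
  have "x \<in> B" if "x \<in> L" "norm x < e" for x
  proof -
    obtain t where t: "x = t *\<^sub>R v"
      using \<open>x \<in> L\<close> v(2) by blast
    with that(2) v(1) have "t \<in> {-e<..<e}"
      by auto
    with e(2) t show ?thesis
      by simp
  qed
  then show ?thesis
    by (intro that[OF e(1)]) blast
qed

section \<open>Linewise derivatives\<close>

text \<open>
  Only on \<open>L\<close> is a derivative within \<open>L\<close> determined; there it is found by differentiating along the curves
  \<open>t \<mapsto> t *\<^sub>R x\<close>, whose parameter ranges over a full neighbourhood of \<open>0\<close>.
\<close>
lemma has_derivative_on_line_unique: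
  fixes F :: "'a::real_normed_vector \<Rightarrow> 'b::real_normed_vector"
  assumes F: "(F has_derivative F') (at 0 within L)" "(F has_derivative G') (at 0 within L)"
    and L: "subspace L" and x: "x \<in> L"
  shows "F' x = G' x"
proof -
  have D: "((\<lambda>t. F (t *\<^sub>R x)) has_derivative (\<lambda>t. H (t *\<^sub>R x))) (at 0)"
    if "(F has_derivative H) (at 0 within L)" for H
  proof -
    have "range (\<lambda>t. t *\<^sub>R x) \<subseteq> L"
      using L x by (auto simp: subspace_scale)
    then have g: "(F has_derivative H) (at (0 *\<^sub>R x) within range (\<lambda>t. t *\<^sub>R x))"
      using has_derivative_subset[OF that] by simp
    have f: "((\<lambda>t. t *\<^sub>R x) has_derivative (\<lambda>t. t *\<^sub>R x)) (at (0::real))"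
      by (auto intro!: derivative_eq_intros)
    show ?thesis
      using has_derivative_in_compose[where f = "\<lambda>t. t *\<^sub>R x" and x = 0 and s = UNIV, OF f g] .
  qed
  have "(\<lambda>t. F' (t *\<^sub>R x)) = (\<lambda>t. G' (t *\<^sub>R x))"
    by (rule has_derivative_unique[OF D[OF F(1)] D[OF F(2)]])
  from fun_cong[OF this, of 1] show ?thesis
    by simp
qed

lemma line_derivative_eqI:
  assumes "(F has_derivative F') (at 0 within L)" "L \<in> RP1"
  shows "line_derivative F L = restrict F' L"
proof -
  have "F differentiable (at 0 within L)"
    using assms(1) by (auto simp: differentiable_def)
  then have "(F has_derivative frechet_derivative F (at 0 within L)) (at 0 within L)"
    by (simp add: frechet_derivative_works)
  from has_derivative_on_line_unique[OF this assms(1)] assms(2) show ?thesis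
    unfolding line_derivative_def by (intro restrict_ext) (simp add: RP1_def)
qed

lemma has_derivative_on_line_local:
  assumes "(F has_derivative F') (at 0 within L)" "L \<in> RP1" "C \<in> D_nbhds pencil 0"
    and "\<And>y. y \<in> C \<Longrightarrow> F y = G y"
  shows "(G has_derivative F') (at 0 within L)"
proof -
  obtain e where e: "e > 0" "\<forall>x\<in>L. norm x < e \<longrightarrow> x \<in> C"
    by (rule D_nbhd_contains_line_segment[OF assms(3,2)])
  show ?thesis
    by (rule has_derivative_transform_within[OF assms(1) e(1) zero_in_RP1[OF assms(2)]])
      (use e(2) assms(4) in auto)
qed

lemma rep_has_derivative_on_line:
  assumes rep: "(B, F) \<in> pencil.reps" and v: "norm v = 1"
  shows "(F has_derivative (\<lambda>x. (x \<bullet> v) * deriv (\<lambda>t. F (t *\<^sub>R v)) 0))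
           (at 0 within range (\<lambda>t. t *\<^sub>R v))"
proof -
  let ?\<phi> = "\<lambda>t. F (t *\<^sub>R v)" and ?L = "range (\<lambda>t. t *\<^sub>R v)"
  have "v \<noteq> 0"
    using v by auto
  obtain e where "e > 0" "\<forall>t\<in>{-e<..<e}. t *\<^sub>R v \<in> B"
    and e: "\<forall>j. \<forall>t\<in>{-e<..<e}.
      ((deriv ^^ j) ?\<phi> has_real_derivative (deriv ^^ Suc j) ?\<phi> t) (at t)"
    using rep_iterated_derivs[OF rep \<open>v \<noteq> 0\<close>] .
  have "(?\<phi> has_real_derivative deriv ?\<phi> 0) (at (0 \<bullet> v))"
    using bspec[OF spec[OF e, of 0], of 0] \<open>e > 0\<close> by simp
  then have g: "(?\<phi> has_derivative (*) (deriv ?\<phi> 0)) (at (0 \<bullet> v) within (\<lambda>x. x \<bullet> v) ` ?L)"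
    unfolding has_field_derivative_def by (rule has_derivative_at_withinI)
  have f: "((\<lambda>x. x \<bullet> v) has_derivative (\<lambda>x. x \<bullet> v)) (at 0 within ?L)"
    by (auto intro!: derivative_eq_intros)
  have "((\<lambda>x. ?\<phi> (x \<bullet> v)) has_derivative (\<lambda>x. deriv ?\<phi> 0 * (x \<bullet> v))) (at 0 within ?L)"
    using has_derivative_in_compose[where f = "\<lambda>x. x \<bullet> v" and x = 0 and s = ?L, OF f g] .
  then have "(F has_derivative (\<lambda>x. deriv ?\<phi> 0 * (x \<bullet> v))) (at 0 within ?L)"
  proof (rule has_derivative_transform[rotated 2])
    show "0 \<in> ?L"
      by (rule image_eqI[of _ _ 0]) simp_all
    show "F x = ?\<phi> (x \<bullet> v)" if "x \<in> ?L" for x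
      using on_line_inner[OF v that] by simp
  qed
  then show ?thesis
    by (simp add: mult.commute)
qed

lemma rep_differentiable:
  assumes "(B, F) \<in> pencil.reps" "L \<in> RP1"
  shows "F differentiable (at 0 within L)"
proof -
  obtain v where v: "norm v = 1" "L = range (\<lambda>t. t *\<^sub>R v)"
    using RP1_obtain_direction[OF assms(2)] .
  show ?thesis
    using rep_has_derivative_on_line[OF assms(1) v(1)] unfolding v(2) by (rule differentiableI)
qed

lemma line_derivative_explicit:
  assumes "(B, F) \<in> pencil.reps" "norm v = 1" "L = range (\<lambda>t. t *\<^sub>R v)"
  shows "line_derivative F L = (\<lambda>x\<in>L. (x \<bullet> v) * deriv (\<lambda>t. F (t *\<^sub>R v)) 0)"
proof -
  have "v \<noteq> 0"
    using assms(2) by auto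
  then have "range (\<lambda>t. t *\<^sub>R v) \<in> RP1"
    by (rule line_in_RP1)
  from line_derivative_eqI[OF rep_has_derivative_on_line[OF assms(1,2)] this] show ?thesis
    unfolding assms(3) .
qed

text \<open>
  The representative chosen by \<open>J_tilde\<close> agrees with \<open>F\<close> on a D-open neighbourhood, hence on a segment of
  \<open>L\<close> around the origin.
\<close>
lemma J_tilde_class:
  assumes rep: "(B, F) \<in> pencil.reps" and L: "L \<in> RP1"
  shows "J_tilde (pencil.cls (B, F)) L = line_derivative F L"
proof -
  define r where "r = (SOME r. r \<in> pencil.cls (B, F))"
  have "r \<in> pencil.cls (B, F)"
    unfolding r_def using pencil.mem_germ_class[OF rep] by (rule someI)
  then have "(fst r, snd r) \<in> pencil.cls (B, F)"
    by simp
  then obtain C where "(fst r, snd r) \<in> pencil.reps" "(B, F) \<in> pencil.reps"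
    and C: "C \<in> D_nbhds pencil 0" "C \<subseteq> B \<inter> fst r" "\<forall>y\<in>C. F y = snd r y"
    by (rule pencil.germ_classE)
  obtain F' where F': "(F has_derivative F') (at 0 within L)"
    using rep_differentiable[OF rep L] by (auto simp: differentiable_def)
  have "(snd r has_derivative F') (at 0 within L)"
    by (rule has_derivative_on_line_local[OF F' L C(1)]) (simp add: C(3))
  from line_derivative_eqI[OF this L] have "line_derivative (snd r) L = line_derivative F L"
    unfolding line_derivative_eqI[OF F' L] .
  then show ?thesis
    using L unfolding J_tilde_def r_def by simp
qed

lemma J_tilde_add:
  assumes "f \<in> pencil.vanishing" "g \<in> pencil.vanishing" "L \<in> RP1"
  shows "J_tilde (f \<oplus>\<^bsub>pencil.germs\<^esub> g) L = (\<lambda>x\<in>L. J_tilde f L x + J_tilde g L x)"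
proof -
  obtain B F where f: "(B, F) \<in> pencil.reps" "f = pencil.cls (B, F)"
    using assms(1) by (rule pencil.vanishing_idealE)
  obtain C G where g: "(C, G) \<in> pencil.reps" "g = pencil.cls (C, G)"
    using assms(2) by (rule pencil.vanishing_idealE)
  obtain F' where F': "(F has_derivative F') (at 0 within L)"
    using rep_differentiable[OF f(1) assms(3)] by (auto simp: differentiable_def)
  obtain G' where G': "(G has_derivative G') (at 0 within L)"
    using rep_differentiable[OF g(1) assms(3)] by (auto simp: differentiable_def)
  note fg = pencil.germ_add[OF f(1) g(1)]
  have nb: "B \<inter> C \<in> D_nbhds pencil 0"
    using fg(1) by (simp add: pencil.germ_reps_iff)
  have "((\<lambda>y\<in>B \<inter> C. F y + G y) has_derivative (\<lambda>x. F' x + G' x)) (at 0 within L)"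
    by (rule has_derivative_on_line_local[OF has_derivative_add[OF F' G'] assms(3) nb]) simp
  from line_derivative_eqI[OF this assms(3)] show ?thesis
    unfolding f(2) g(2) fg(2) J_tilde_class[OF fg(1) assms(3)]
      J_tilde_class[OF f(1) assms(3)] J_tilde_class[OF g(1) assms(3)]
      line_derivative_eqI[OF F' assms(3)] line_derivative_eqI[OF G' assms(3)]
    by (simp cong: restrict_cong)
qed

lemma J_tilde_mult:
  assumes "f \<in> pencil.vanishing" "g \<in> pencil.vanishing" "L \<in> RP1"
  shows "J_tilde (f \<otimes>\<^bsub>pencil.germs\<^esub> g) L = (\<lambda>x\<in>L. 0)"
proof -
  obtain B F where f: "(B, F) \<in> pencil.reps" "f = pencil.cls (B, F)" "F 0 = 0"
    using assms(1) by (rule pencil.vanishing_idealE)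
  obtain C G where g: "(C, G) \<in> pencil.reps" "g = pencil.cls (C, G)" "G 0 = 0"
    using assms(2) by (rule pencil.vanishing_idealE)
  obtain F' where F': "(F has_derivative F') (at 0 within L)"
    using rep_differentiable[OF f(1) assms(3)] by (auto simp: differentiable_def)
  obtain G' where G': "(G has_derivative G') (at 0 within L)"
    using rep_differentiable[OF g(1) assms(3)] by (auto simp: differentiable_def)
  note fg = pencil.germ_mult[OF f(1) g(1)]
  have nb: "B \<inter> C \<in> D_nbhds pencil 0"
    using fg(1) by (simp add: pencil.germ_reps_iff)
  have "((\<lambda>y\<in>B \<inter> C. F y * G y) has_derivative (\<lambda>x. F 0 * G' x + F' x * G 0)) (at 0 within L)"
    by (rule has_derivative_on_line_local[OF has_derivative_mult[OF F' G'] assms(3) nb]) simp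
  from line_derivative_eqI[OF this assms(3)] show ?thesis
    unfolding f(2) g(2) fg(2) J_tilde_class[OF fg(1) assms(3)] by (simp add: f(3) g(3))
qed

lemma J_tilde_smult:
  assumes "f \<in> pencil.vanishing" "L \<in> RP1"
  shows "J_tilde (a \<odot>\<^bsub>pencil.germs\<^esub> f) L = (\<lambda>x\<in>L. a * J_tilde f L x)"
proof -
  obtain B F where f: "(B, F) \<in> pencil.reps" "f = pencil.cls (B, F)"
    using assms(1) by (rule pencil.vanishing_idealE)
  obtain F' where F': "(F has_derivative F') (at 0 within L)"
    using rep_differentiable[OF f(1) assms(2)] by (auto simp: differentiable_def)
  note af = pencil.germ_smult[OF f(1), of a]
  have nb: "B \<in> D_nbhds pencil 0"
    using af(1) by (simp add: pencil.germ_reps_iff)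
  have "((\<lambda>y\<in>B. a * F y) has_derivative (\<lambda>x. a * F' x)) (at 0 within L)"
    by (rule has_derivative_on_line_local[OF has_derivative_mult_right[OF F'] assms(2) nb]) simp
  from line_derivative_eqI[OF this assms(2)] show ?thesis
    unfolding f(2) af(2) J_tilde_class[OF af(1) assms(2)] J_tilde_class[OF f(1) assms(2)]
      line_derivative_eqI[OF F' assms(2)]
    by (simp cong: restrict_cong)
qed

lemma J_tilde_carrier:
  assumes "f \<in> pencil.vanishing"
  shows "J_tilde f \<in> carrier dual_product"
proof -
  obtain B F where f: "(B, F) \<in> pencil.reps" "f = pencil.cls (B, F)"
    using assms(1) by (rule pencil.vanishing_idealE)
  have "J_tilde f L \<in> carrier (dual_space L)" if L: "L \<in> RP1" for L
  proof -
    obtain v where v: "norm v = 1" "L = range (\<lambda>t. t *\<^sub>R v)"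
      using RP1_obtain_direction[OF L] .
    have "subspace L"
      using L by (simp add: RP1_def)
    then show ?thesis
      unfolding f(2) J_tilde_class[OF f(1) L] line_derivative_explicit[OF f(1) v]
      by (auto simp: dual_space_def subspace_add subspace_scale inner_add_left algebra_simps)
  qed
  moreover have "J_tilde f \<in> extensional RP1"
    by (simp add: J_tilde_def)
  ultimately show ?thesis
    by (simp add: dual_product_def product_space_def PiE_def)
qed

lemma J_tilde_linear: "linear_map (vanishing_space pencil 0) dual_product J_tilde"
proof -
  have ext: "J_tilde f \<in> extensional RP1" for f
    by (simp add: J_tilde_def)
  have add: "J_tilde (f \<oplus>\<^bsub>pencil.germs\<^esub> g) = J_tilde f \<oplus>\<^bsub>dual_product\<^esub> J_tilde g"
    if "f \<in> pencil.vanishing" "g \<in> pencil.vanishing" for f g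
  proof (rule extensionalityI[OF ext])
    show "J_tilde f \<oplus>\<^bsub>dual_product\<^esub> J_tilde g \<in> extensional RP1"
      by (simp add: dual_product_def product_space_def)
    show "J_tilde (f \<oplus>\<^bsub>pencil.germs\<^esub> g) L = (J_tilde f \<oplus>\<^bsub>dual_product\<^esub> J_tilde g) L"
      if "L \<in> RP1" for L
      using that J_tilde_add[OF \<open>f \<in> pencil.vanishing\<close> \<open>g \<in> pencil.vanishing\<close> that]
      by (simp add: dual_product_def product_space_def dual_space_def)
  qed
  have smult: "J_tilde (a \<odot>\<^bsub>pencil.germs\<^esub> f) = a \<odot>\<^bsub>dual_product\<^esub> J_tilde f"
    if "f \<in> pencil.vanishing" for f a
  proof (rule extensionalityI[OF ext])
    show "a \<odot>\<^bsub>dual_product\<^esub> J_tilde f \<in> extensional RP1"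
      by (simp add: dual_product_def product_space_def)
    show "J_tilde (a \<odot>\<^bsub>pencil.germs\<^esub> f) L = (a \<odot>\<^bsub>dual_product\<^esub> J_tilde f) L"
      if "L \<in> RP1" for L
      using that J_tilde_smult[OF \<open>f \<in> pencil.vanishing\<close> that]
      by (simp add: dual_product_def product_space_def dual_space_def)
  qed
  have sel: "carrier (vanishing_space pencil 0) = pencil.vanishing"
    "add (vanishing_space pencil 0) = add pencil.germs" "smult (vanishing_space pencil 0) = smult pencil.germs"
    by (simp_all add: vanishing_space_def)
  show ?thesis
    unfolding linear_map_def sel by (intro conjI ballI allI funcsetI J_tilde_carrier add smult)
qed

section \<open>Smoothness of the linewise derivatives\<close>

text \<open>
  A plot \<open>q\<close> of functions makes \<open>q u (t *\<^sub>R v)\<close> a smooth function of the \<open>n + 1\<close> variables \<open>u\<close> and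
  \<open>t\<close> on an open set. Its partial derivative with respect to \<open>t\<close> is smooth there, and so is the
  restriction of this derivative to the slice \<open>t = 0\<close>.
\<close>
lemma diff_fun_line_derivative_smooth:
  assumes B: "B \<in> D_nbhds pencil 0" and v: "v \<noteq> 0"
    and q: "(n, U, q) \<in> plots (diff_fun (diff_sub pencil B) diff_real)"
  shows "smooth_real n U (\<lambda>u. deriv (\<lambda>t. q u (t *\<^sub>R v)) 0)"
proof -
  have U: "openin (Euclidean_space n) U"
    using q by (simp add: diff_fun_def parametrizations_def)
  then obtain T where T: "open T" "U = {x. \<forall>i\<ge>n. x i = 0} \<inter> T"
    unfolding openin_Euclidean_space by blast
  have adj: "diff_smooth (diff_pair (diff_open n U) (diff_sub pencil B)) diff_real (\<lambda>(u, x). q u x)"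
    using q by (simp add: diff_fun_def)
  \<comment> \<open>In \<open>Suc n\<close> variables, coordinate \<open>n\<close> is the parameter of the line and the others are \<open>u\<close>.\<close>
  define S where "S = {w :: nat \<Rightarrow> real. \<forall>i\<ge>Suc n. w i = 0}"
  define A where "A = {w \<in> S. w(n := 0) \<in> T}"
  define W where "W = {w \<in> A. w n *\<^sub>R v \<in> B}"
  have "continuous_on S (\<lambda>w. w(n := 0))"
  proof (rule continuous_on_coordinatewise_then_product)
    fix i
    have "continuous_on S (\<lambda>w. w i)"
      by (rule continuous_on_subset[OF continuous_on_product_coordinates subset_UNIV])
    then show "continuous_on S (\<lambda>w. (w(n := 0)) i)"
      by (cases "i = n") simp_all
  qed
  then have A: "openin (Euclidean_space (Suc n)) A"
    unfolding A_def S_def by (intro openin_Euclidean_preimage openin_Euclidean_whole T)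
  have W: "openin (Euclidean_space (Suc n)) W"
    unfolding W_def by (intro D_nbhd_line_domain A smooth_real_coord v B)
  have base: "w(n := 0) \<in> U" if "w \<in> W" for w
    using that by (auto simp: W_def A_def S_def T(2) Suc_le_eq)
  have "(Suc n, W, \<lambda>w. (w(n := 0), w n *\<^sub>R v)) \<in> plots (diff_pair (diff_open n U) (diff_sub pencil B))"
  proof -
    have "smooth_coord (Suc n) W n (\<lambda>w. w(n := 0))"
      unfolding smooth_coord_def
    proof (intro allI impI)
      fix i assume "i < n"
      then show "smooth_real (Suc n) W (\<lambda>w. (w(n := 0)) i)"
        using smooth_real_coord[OF W, of i] by simp
    qed
    moreover have "(Suc n, W, \<lambda>w. w n *\<^sub>R v) \<in> plots pencil"
      by (intro pencil_line_plot W smooth_real_coord v)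
    moreover have "w n *\<^sub>R v \<in> B" if "w \<in> W" for w
      using that by (simp add: W_def)
    ultimately show ?thesis
      using W base
      by (auto simp: diff_pair_def diff_open_def diff_sub_def parametrizations_def comp_def)
  qed
  with adj have "(Suc n, W, (\<lambda>(u, x). q u x) \<circ> (\<lambda>w. (w(n := 0), w n *\<^sub>R v))) \<in> plots diff_real"
    unfolding diff_smooth_def by blast
  then have "smooth_real (Suc n) W (\<lambda>w. q (w(n := 0)) (w n *\<^sub>R v))"
    by (simp add: diff_euclidean_def smooth_euclidean_real comp_def)
  from smooth_real_partial[OF this, of n]
  have sm: "smooth_real (Suc n) W
      (\<lambda>w. deriv (\<lambda>t. q ((w(n := t))(n := 0)) ((w(n := t)) n *\<^sub>R v)) (w n))"
    by simp
  have US: "U \<subseteq> {x. \<forall>i\<ge>n. x i = 0}"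
    using T(2) by blast
  have UW: "U \<subseteq> W"
  proof
    fix u assume u: "u \<in> U"
    then have "\<forall>i\<ge>n. u i = 0" "u \<in> T"
      using T(2) by auto
    moreover from this have "u(n := 0) = u"
      by (intro fun_upd_idem) simp
    moreover have "0 \<in> B"
      using B by (simp add: D_nbhds_def)
    ultimately show "u \<in> W"
      by (simp add: W_def A_def S_def)
  qed
  from smooth_real_slice[OF sm _ UW US] show ?thesis
  proof (rule smooth_real_cong[OF U, rotated])
    show "n \<le> Suc n"
      by simp
    fix u assume "u \<in> U"
    then have "u n = 0"
      using US by auto
    then have "u(n := 0) = u"
      by (intro fun_upd_idem)
    with \<open>u n = 0\<close>
    show "deriv (\<lambda>t. q ((u(n := t))(n := 0)) ((u(n := t)) n *\<^sub>R v)) (u n) = deriv (\<lambda>t. q u (t *\<^sub>R v)) 0"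
      by simp
  qed
qed

text \<open>
  The dual of the line spanned by \<open>v\<close> is spanned by \<open>x \<mapsto> x \<bullet> v\<close>, so a parametrization of it is smooth if
  its coefficient \<open>c\<close> is.
\<close>
lemma dual_line_functional:
  assumes l: "linear_map (dual_space L) real_space l" and L: "subspace L"
  shows "l (\<lambda>x\<in>L. (x \<bullet> v) * c) = c * l (\<lambda>x\<in>L. x \<bullet> v)"
proof -
  have "(\<lambda>x\<in>L. x \<bullet> v) \<in> carrier (dual_space L)"
    using L by (auto simp: dual_space_def subspace_add subspace_scale inner_add_left)
  with l have "l (c \<odot>\<^bsub>dual_space L\<^esub> (\<lambda>x\<in>L. x \<bullet> v)) = c * l (\<lambda>x\<in>L. x \<bullet> v)"
    unfolding linear_map_def real_space_def by simp
  moreover have "c \<odot>\<^bsub>dual_space L\<^esub> (\<lambda>x\<in>L. x \<bullet> v) = (\<lambda>x\<in>L. (x \<bullet> v) * c)"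
    by (auto simp: dual_space_def mult.commute)
  ultimately show ?thesis
    by simp
qed

lemma plots_diff_dual_product:
  "(n, U, p) \<in> plots diff_dual_product \<longleftrightarrow>
     openin (Euclidean_space n) U \<and> p ` U \<subseteq> carrier dual_product \<and>
     (\<forall>L\<in>RP1. \<forall>l. linear_map (dual_space L) real_space l \<longrightarrow> smooth_real n U (\<lambda>u. l (p u L)))"
  unfolding diff_dual_product_def diff_prod_def diff_vector_space_def dual_product_def
    product_space_def parametrizations_def
  by (auto simp: comp_def image_subset_iff PiE_iff)

text \<open>
  Plots of germs and plots of cosets lift to representatives only locally, so maps out of these spaces
  are shown to be smooth locally in the parameter.
\<close>
lemma diff_dual_product_local:
  assumes U: "openin (Euclidean_space n) U"
    and loc: "\<And>u. u \<in> U \<Longrightarrow> \<exists>V q. openin (Euclidean_space n) V \<and> u \<in> V \<and> V \<subseteq> U \<and>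
                (n, V, q) \<in> plots diff_dual_product \<and> (\<forall>w\<in>V. p w = q w)"
  shows "(n, U, p) \<in> plots diff_dual_product"
  unfolding plots_diff_dual_product
proof (intro conjI ballI allI impI U image_subsetI)
  fix u assume "u \<in> U"
  from loc[OF this] obtain V q where "u \<in> V" "(n, V, q) \<in> plots diff_dual_product" "\<forall>w\<in>V. p w = q w"
    by blast
  then show "p u \<in> carrier dual_product"
    unfolding plots_diff_dual_product by auto
next
  fix L l assume L: "L \<in> RP1" and l: "linear_map (dual_space L) real_space l"
  show "smooth_real n U (\<lambda>u. l (p u L))"
  proof (rule smooth_real_local[OF U])
    fix u assume "u \<in> U"
    from loc[OF this] obtain V q where V: "openin (Euclidean_space n) V" "u \<in> V" "V \<subseteq> U"
      and q: "(n, V, q) \<in> plots diff_dual_product" "\<forall>w\<in>V. p w = q w"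
      by blast
    have "smooth_real n V (\<lambda>u. l (q u L))"
      using q(1) L l by (simp add: plots_diff_dual_product)
    then have "smooth_real n V (\<lambda>u. l (p u L))"
      by (rule smooth_real_cong[OF V(1), rotated]) (simp add: q(2))
    with V show "\<exists>V. openin (Euclidean_space n) V \<and> u \<in> V \<and> V \<subseteq> U \<and> smooth_real n V (\<lambda>u. l (p u L))"
      by blast
  qed
qed

lemma J_tilde_smooth_on_reps:
  assumes B: "B \<in> D_nbhds pencil 0"
    and q: "(n, U, q) \<in> plots (diff_fun (diff_sub pencil B) diff_real)"
    and van: "\<And>u. u \<in> U \<Longrightarrow> pencil.cls (B, q u) \<in> pencil.vanishing"
  shows "(n, U, \<lambda>u. J_tilde (pencil.cls (B, q u))) \<in> plots diff_dual_product"
  unfolding plots_diff_dual_product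
proof (intro conjI ballI allI impI image_subsetI)
  show U: "openin (Euclidean_space n) U"
    using q by (simp add: diff_fun_def parametrizations_def)
  show "J_tilde (pencil.cls (B, q u)) \<in> carrier dual_product" if "u \<in> U" for u
    by (rule J_tilde_carrier[OF van[OF that]])
  have rep: "(B, q u) \<in> pencil.reps" if "u \<in> U" for u
    using q B that by (auto simp: germ_reps_def diff_coprod_def diff_fun_def parametrizations_def)
  fix L l assume L: "L \<in> RP1" and l: "linear_map (dual_space L) real_space l"
  obtain v where v: "norm v = 1" "L = range (\<lambda>t. t *\<^sub>R v)"
    using RP1_obtain_direction[OF L] .
  have "v \<noteq> 0" "subspace L"
    using v(1) L by (auto simp: RP1_def)
  have "smooth_real n U (\<lambda>u. deriv (\<lambda>t. q u (t *\<^sub>R v)) 0 * l (\<lambda>x\<in>L. x \<bullet> v))"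
    by (rule smooth_real_mult[OF U diff_fun_line_derivative_smooth[OF B \<open>v \<noteq> 0\<close> q]
          smooth_real_const[OF U]])
  then show "smooth_real n U (\<lambda>u. l (J_tilde (pencil.cls (B, q u)) L))"
  proof (rule smooth_real_cong[OF U, rotated])
    fix u assume "u \<in> U"
    show "deriv (\<lambda>t. q u (t *\<^sub>R v)) 0 * l (\<lambda>x\<in>L. x \<bullet> v) = l (J_tilde (pencil.cls (B, q u)) L)"
      unfolding J_tilde_class[OF rep[OF \<open>u \<in> U\<close>] L] line_derivative_explicit[OF rep[OF \<open>u \<in> U\<close>] v]
        dual_line_functional[OF l \<open>subspace L\<close>] ..
  qed
qed

lemma points_diff_dual_product: "points diff_dual_product = carrier dual_product"
  by (simp add: diff_dual_product_def diff_prod_def diff_vector_space_def dual_product_def product_space_def)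

lemma J_tilde_smooth: "diff_smooth (diff_vanishing pencil 0) diff_dual_product J_tilde"
  unfolding diff_smooth_def
proof (intro conjI allI impI)
  show "J_tilde \<in> points (diff_vanishing pencil 0) \<rightarrow> points diff_dual_product"
    using J_tilde_carrier by (simp add: diff_vanishing_def diff_sub_def points_diff_dual_product)
  fix n U p assume "(n, U, p) \<in> plots (diff_vanishing pencil 0)"
  then have pI: "p ` U \<subseteq> pencil.vanishing" and p: "(n, U, p) \<in> plots (diff_germs pencil 0)"
    by (simp_all add: diff_vanishing_def diff_sub_def)
  have U: "openin (Euclidean_space n) U"
    using p by (simp add: diff_germs_def diff_quot_def parametrizations_def)
  show "(n, U, J_tilde \<circ> p) \<in> plots diff_dual_product"
  proof (rule diff_dual_product_local[OF U])
    fix u assume u: "u \<in> U"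
    have "\<forall>u\<in>U. \<exists>V q. openin (Euclidean_space n) V \<and> u \<in> V \<and> V \<subseteq> U \<and>
        (n, V, q) \<in> plots (germ_reps pencil 0) \<and> (\<forall>w\<in>V. p w = pencil.cls (q w))"
      using p by (simp add: diff_germs_def diff_quot_def)
    from bspec[OF this u] obtain V q
      where V: "u \<in> V" "V \<subseteq> U" "\<forall>w\<in>V. p w = pencil.cls (q w)"
        and q: "(n, V, q) \<in> plots (germ_reps pencil 0)"
      by blast
    have "\<forall>u\<in>V. \<exists>W B r. openin (Euclidean_space n) W \<and> u \<in> W \<and> W \<subseteq> V \<and> B \<in> D_nbhds pencil 0 \<and>
        (n, W, r) \<in> plots (diff_fun (diff_sub pencil B) diff_real) \<and> (\<forall>w\<in>W. q w = (B, r w))"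
      using q by (simp add: germ_reps_def diff_coprod_def)
    from bspec[OF this V(1)] obtain W B r
      where W: "openin (Euclidean_space n) W" "u \<in> W" "W \<subseteq> V" and B: "B \<in> D_nbhds pencil 0"
        and r: "(n, W, r) \<in> plots (diff_fun (diff_sub pencil B) diff_real)" "\<forall>w\<in>W. q w = (B, r w)"
      by blast
    have eq: "p w = pencil.cls (B, r w)" if "w \<in> W" for w
      using V(3) W(3) r(2) that by auto
    have "(n, W, \<lambda>w. J_tilde (pencil.cls (B, r w))) \<in> plots diff_dual_product"
    proof (rule J_tilde_smooth_on_reps[OF B r(1)])
      fix w assume w: "w \<in> W"
      then have "p w \<in> pencil.vanishing"
        using pI V(2) W(3) by blast
      then show "pencil.cls (B, r w) \<in> pencil.vanishing"
        unfolding eq[OF w] .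
    qed
    moreover have "\<forall>w\<in>W. (J_tilde \<circ> p) w = J_tilde (pencil.cls (B, r w))"
      by (simp add: eq)
    moreover have "W \<subseteq> U"
      using V(2) W(3) by blast
    ultimately show "\<exists>V q. openin (Euclidean_space n) V \<and> u \<in> V \<and> V \<subseteq> U \<and>
        (n, V, q) \<in> plots diff_dual_product \<and> (\<forall>w\<in>V. (J_tilde \<circ> p) w = q w)"
      using W(1,2) by blast
  qed
qed

section \<open>Dividing a germ by the pivot\<close>

text \<open>
  The plane without the parabolas $y = \pm x^2$, but with the origin. Both parabolas are tangent to the
  x-axis, which runs between them.
\<close>
definition off_parabolas :: "(real^2) set" where
  "off_parabolas = {x. x = 0 \<or> \<bar>x $ 2\<bar> \<noteq> (x $ 1)\<^sup>2}"

text \<open>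
  On \<open>off_parabolas\<close> minus the origin, each of the two cases describes an open set, so there the jumps
  between the two coordinates do no harm.
\<close>
definition pivot :: "real^2 \<Rightarrow> real" where
  "pivot x = (if \<bar>x $ 2\<bar> > (x $ 1)\<^sup>2 then x $ 2 else x $ 1)"

lemma pivot_nonzero: "x \<in> off_parabolas \<Longrightarrow> x \<noteq> 0 \<Longrightarrow> pivot x \<noteq> 0"
  by (auto simp: off_parabolas_def pivot_def)

text \<open>
  On the x-axis, \<open>\<bar>x $ 2\<bar>\<close> is zero and the first coordinate is the pivot. On a line spanned by a unit
  vector \<open>v\<close> with \<open>v $ 2 \<noteq> 0\<close>, the inequality \<open>\<bar>t * v $ 2\<bar> > (t * v $ 1)\<^sup>2\<close> holds as soon as
  \<open>0 < \<bar>t\<bar> < \<bar>v $ 2\<bar>\<close>, and the second coordinate is the pivot.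
\<close>
lemma pivot_linear_on_line:
  assumes "L \<in> RP1"
  obtains e i where "e > 0"
    "\<forall>x\<in>L. norm x < e \<longrightarrow> x \<in> off_parabolas \<and> pivot x = x $ i \<and> (x $ i = 0 \<longrightarrow> x = 0)"
proof -
  obtain v where v: "norm v = 1" "L = range (\<lambda>t. t *\<^sub>R v)"
    using RP1_obtain_direction[OF assms] .
  show ?thesis
  proof (cases "v $ 2 = 0")
    case True
    have "x \<in> off_parabolas \<and> pivot x = x $ 1 \<and> (x $ 1 = 0 \<longrightarrow> x = 0)" if "x \<in> L" for x
    proof -
      have "x $ 2 = 0"
        using that True v(2) by auto
      then show ?thesis
        by (auto simp: off_parabolas_def pivot_def vec_eq_iff forall_2)
    qed
    then show ?thesis
      by (intro that[of 1 1]) auto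
  next
    case False
    have "x \<in> off_parabolas \<and> pivot x = x $ 2 \<and> (x $ 2 = 0 \<longrightarrow> x = 0)"
      if "x \<in> L" "norm x < \<bar>v $ 2\<bar>" for x
    proof (cases "x = 0")
      case True
      then show ?thesis
        by (simp add: off_parabolas_def pivot_def)
    next
      case False
      obtain t where t: "x = t *\<^sub>R v"
        using \<open>x \<in> L\<close> v(2) by blast
      have t0: "\<bar>t\<bar> > 0" "\<bar>t\<bar> < \<bar>v $ 2\<bar>"
        using False that(2) v(1) t by auto
      \<comment> \<open>\<open>\<bar>x $ 2\<bar>\<close> is of first order in \<open>t\<close> and \<open>(x $ 1)\<^sup>2\<close> of second order.\<close>
      have "\<bar>v $ 1\<bar> \<le> 1"
        using component_le_norm_cart[of v 1] v(1) by simp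
      then have "(v $ 1)\<^sup>2 \<le> 1"
        by (simp add: abs_square_le_1)
      then have "(x $ 1)\<^sup>2 \<le> \<bar>t\<bar> * \<bar>t\<bar>"
        using mult_left_mono[of "(v $ 1)\<^sup>2" 1 "t\<^sup>2"] by (simp add: t power2_eq_square mult_ac)
      also have "\<dots> < \<bar>t\<bar> * \<bar>v $ 2\<bar>"
        using t0 by (intro mult_strict_left_mono)
      finally have "(x $ 1)\<^sup>2 < \<bar>x $ 2\<bar>"
        by (simp add: t abs_mult)
      then show ?thesis
        using zero_le_power2[of "x $ 1"] by (auto simp: off_parabolas_def pivot_def)
    qed
    then show ?thesis
      using False by (intro that[of "\<bar>v $ 2\<bar>" 2]) auto
  qed
qed

text \<open>
  Near a given parameter a plot either avoids the origin or stays inside one line. In the first case a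
  smaller domain is mapped into one of the two regions, in the second case into a short segment of the line;
  either way the pivot is one fixed coordinate along the plot.
\<close>
lemma pivot_along_plot:
  assumes p: "(n, U, p) \<in> plots pencil" and u: "u \<in> U" "p u \<in> off_parabolas"
  obtains V i where "openin (Euclidean_space n) V" "u \<in> V" "V \<subseteq> U" "p ` V \<subseteq> off_parabolas"
    "smooth_euclidean n V p"
    "\<forall>w\<in>V. pivot (p w) = p w $ i \<and> (p w $ i = 0 \<longrightarrow> p w = 0)"
    "0 \<notin> p ` V \<or> (\<exists>L\<in>RP1. p ` V \<subseteq> L)"
proof -
  have "\<forall>u\<in>U. \<exists>V. openin (Euclidean_space n) V \<and> u \<in> V \<and> V \<subseteq> U \<and>
      (p u \<noteq> 0 \<and> smooth_euclidean n V p \<or>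
       p u = 0 \<and> (\<exists>L\<in>RP1. p ` V \<subseteq> L \<and> smooth_euclidean n V p))"
    using p by (simp add: pencil_def)
  from bspec[OF this u(1)] obtain V
    where V: "openin (Euclidean_space n) V" "u \<in> V" "V \<subseteq> U" "smooth_euclidean n V p"
      and cases: "p u \<noteq> 0 \<or> p u = 0 \<and> (\<exists>L\<in>RP1. p ` V \<subseteq> L)"
    by blast
  have shrink: "openin (Euclidean_space n) {w \<in> V. p w \<in> T} \<and> smooth_euclidean n {w \<in> V. p w \<in> T} p"
    if "open T" for T
    using V(4) by (auto intro: smooth_euclidean_subset
        openin_Euclidean_preimage[OF V(1) smooth_euclidean_continuous_on[OF V(1,4)] that])
  from cases show ?thesis
  proof
    assume "p u \<noteq> 0"
    with u(2) consider "(p u $ 1)\<^sup>2 < \<bar>p u $ 2\<bar>" | "\<bar>p u $ 2\<bar> < (p u $ 1)\<^sup>2"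
      by (fastforce simp: off_parabolas_def)
    then show ?thesis
    proof cases
      case 1
      let ?T = "{x :: real^2. (x $ 1)\<^sup>2 < \<bar>x $ 2\<bar>}"
      have "open ?T"
        by (intro open_Collect_less continuous_intros)
      moreover have "x $ 2 \<noteq> 0" if "x \<in> ?T" for x :: "real^2"
        using that zero_le_power2[of "x $ 1"] by auto
      ultimately show ?thesis
        using shrink[of ?T] V(2,3) 1
        by (intro that[of "{w \<in> V. p w \<in> ?T}" 2]) (auto simp: off_parabolas_def pivot_def)
    next
      case 2
      let ?T = "{x :: real^2. \<bar>x $ 2\<bar> < (x $ 1)\<^sup>2}"
      have "open ?T"
        by (intro open_Collect_less continuous_intros)
      moreover have "x $ 1 \<noteq> 0" if "x \<in> ?T" for x :: "real^2"
        using that by auto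
      ultimately show ?thesis
        using shrink[of ?T] V(2,3) 2
        by (intro that[of "{w \<in> V. p w \<in> ?T}" 1]) (auto simp: off_parabolas_def pivot_def)
    qed
  next
    assume "p u = 0 \<and> (\<exists>L\<in>RP1. p ` V \<subseteq> L)"
    then obtain L where "p u = 0" and L: "L \<in> RP1" "p ` V \<subseteq> L"
      by blast
    obtain e i where e: "e > 0"
      "\<forall>x\<in>L. norm x < e \<longrightarrow> x \<in> off_parabolas \<and> pivot x = x $ i \<and> (x $ i = 0 \<longrightarrow> x = 0)"
      using pivot_linear_on_line[OF L(1)] .
    have V': "p w \<in> off_parabolas \<and> pivot (p w) = p w $ i \<and> (p w $ i = 0 \<longrightarrow> p w = 0)"
      if "w \<in> {w \<in> V. p w \<in> ball 0 e}" for w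
      using e(2) L(2) that by (simp add: image_subset_iff)
    have "0 \<notin> p ` {w \<in> V. p w \<in> ball 0 e} \<or> (\<exists>L\<in>RP1. p ` {w \<in> V. p w \<in> ball 0 e} \<subseteq> L)"
      using L by blast
    then show ?thesis
      using shrink[of "ball 0 e"] V(2,3) \<open>p u = 0\<close> e(1) V'
      by (intro that[of "{w \<in> V. p w \<in> ball 0 e}" i]) auto
  qed
qed

lemma off_parabolas_D_nbhd: "off_parabolas \<in> D_nbhds pencil 0"
proof -
  have "openin (Euclidean_space n) {u \<in> U. p u \<in> off_parabolas}" if p: "(n, U, p) \<in> plots pencil" for n U p
  proof (rule openin_Euclidean_space_local)
    fix u assume u: "u \<in> {u \<in> U. p u \<in> off_parabolas}"
    then have "u \<in> U" "p u \<in> off_parabolas"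
      by simp_all
    then show "\<exists>V. openin (Euclidean_space n) V \<and> u \<in> V \<and> V \<subseteq> {u \<in> U. p u \<in> off_parabolas}"
      by (rule pivot_along_plot[OF p]) blast
  qed
  then show ?thesis
    by (simp add: D_nbhds_def openin_D_topology off_parabolas_def pencil_def)
qed

lemma smooth_euclidean_component:
  fixes p :: "(nat \<Rightarrow> real) \<Rightarrow> real^'n"
  assumes "openin (Euclidean_space n) U" "smooth_euclidean n U p"
  shows "smooth_real n U (\<lambda>u. p u $ i)"
  using smooth_euclidean_inner[OF assms, of "axis i 1"] by (simp add: inner_axis)

lemma pivot_rep: "(off_parabolas, restrict pivot off_parabolas) \<in> pencil.reps"
  unfolding pencil.germ_reps_iff
proof (intro conjI allI impI off_parabolas_D_nbhd)
  fix n U p assume "(n, U, p) \<in> plots pencil \<and> p ` U \<subseteq> off_parabolas"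
  then have p: "(n, U, p) \<in> plots pencil" and sub: "p ` U \<subseteq> off_parabolas"
    by simp_all
  show "smooth_real n U (\<lambda>u. restrict pivot off_parabolas (p u))"
  proof (rule smooth_real_local[OF pencil.openin_plot_domain[OF p]])
    fix u assume u: "u \<in> U"
    with sub have "p u \<in> off_parabolas"
      by blast
    then obtain V i where V: "openin (Euclidean_space n) V" "u \<in> V" "V \<subseteq> U" "p ` V \<subseteq> off_parabolas"
      "smooth_euclidean n V p" "\<forall>w\<in>V. pivot (p w) = p w $ i \<and> (p w $ i = 0 \<longrightarrow> p w = 0)"
      "0 \<notin> p ` V \<or> (\<exists>L\<in>RP1. p ` V \<subseteq> L)"
      by (rule pivot_along_plot[OF p u])
    have "smooth_real n V (\<lambda>u. restrict pivot off_parabolas (p u))"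
      by (rule smooth_real_cong[OF V(1) _ smooth_euclidean_component[OF V(1,5), of i]])
        (use V(4,6) in auto)
    with V(1,2,3) show "\<exists>V. openin (Euclidean_space n) V \<and> u \<in> V \<and> V \<subseteq> U \<and>
        smooth_real n V (\<lambda>u. restrict pivot off_parabolas (p u))"
      by blast
  qed
qed simp

text \<open>
  Along a plot inside a line, \<open>F\<close> is a function \<open>\<phi>\<close> of the line parameter \<open>s\<close>, and \<open>pivot\<close> is a constant
  multiple of \<open>s\<close>. By Hadamard's lemma \<open>\<phi> s / s\<close> is a smooth function of \<open>s\<close>. Its value at \<open>s = 0\<close> is the
  derivative of \<open>F\<close> along the line; this is zero, and so is \<open>F (p w) / pivot (p w)\<close> for \<open>p w = 0\<close>, as
  division by zero yields zero.
\<close>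
lemma quotient_by_pivot_smooth_on_line:
  assumes rep: "(B, F) \<in> pencil.reps" and F0: "F 0 = 0"
    and L: "L \<in> RP1" "line_derivative F L = (\<lambda>x\<in>L. 0)"
    and V: "openin (Euclidean_space n) V" "smooth_euclidean n V p" "p ` V \<subseteq> L" "u \<in> V" "p u = 0"
    and i: "\<forall>w\<in>V. pivot (p w) = p w $ i \<and> (p w $ i = 0 \<longrightarrow> p w = 0)"
  obtains W where "openin (Euclidean_space n) W" "u \<in> W" "W \<subseteq> V"
    "smooth_real n W (\<lambda>w. F (p w) / pivot (p w))"
proof -
  obtain v where v: "norm v = 1" "L = range (\<lambda>t. t *\<^sub>R v)"
    using RP1_obtain_direction[OF L(1)] .
  have "v \<noteq> 0" "v \<bullet> v = 1"
    using v(1) by (auto simp: norm_eq_1)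
  define D where "D = (\<lambda>j. (deriv ^^ j) (\<lambda>t. F (t *\<^sub>R v)))"
  obtain e where e: "e > 0" "\<forall>t\<in>{-e<..<e}. t *\<^sub>R v \<in> B"
    and D: "\<forall>j. \<forall>t\<in>{-e<..<e}. (D j has_real_derivative D (Suc j) t) (at t)"
    using rep_iterated_derivs[OF rep \<open>v \<noteq> 0\<close>] unfolding D_def .
  have D0: "D 0 t = F (t *\<^sub>R v)" for t
    by (simp add: D_def)
  have "v \<in> L"
    unfolding v(2) by (rule image_eqI[of _ _ 1]) simp_all
  have "(v \<bullet> v) * deriv (\<lambda>t. F (t *\<^sub>R v)) 0 = 0"
    using fun_cong[OF line_derivative_explicit[OF rep v], of v] \<open>v \<in> L\<close> unfolding L(2) by simp
  then have D1: "D 1 0 = 0"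
    using \<open>v \<bullet> v = 1\<close> by (simp add: D_def)
  obtain E where E: "\<And>j t. t \<in> {-e<..<e} \<Longrightarrow> (E j has_real_derivative E (Suc j) t) (at t)"
    "\<And>t. t \<in> {-e<..<e} \<Longrightarrow> D 0 t = D 0 0 + t * E 0 t" "E 0 0 = D 1 0"
    by (rule hadamard_quotient[of e D]) (use D e(1) in blast)+
  \<comment> \<open>The line parameter of the plot: \<open>p w = s w *\<^sub>R v\<close>.\<close>
  define s where "s w = p w \<bullet> v" for w
  have ps: "p w = s w *\<^sub>R v" if "w \<in> V" for w
    unfolding s_def using on_line_inner[OF v(1)] V(3) that unfolding v(2) by blast
  have s: "smooth_real n V s"
    unfolding s_def by (rule smooth_euclidean_inner[OF V(1,2)])
  define W where "W = {w \<in> V. s w \<in> {-e<..<e}}"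
  have W: "openin (Euclidean_space n) W"
    unfolding W_def
    by (rule openin_Euclidean_preimage[OF V(1) smooth_real_continuous_on[OF V(1) s] open_greaterThanLessThan])
  have "W \<subseteq> V"
    by (auto simp: W_def)
  have "smooth_real n W (\<lambda>w. E 0 (s w))"
    by (rule smooth_real_compose[where D = E and S = "{-e<..<e}",
          OF W smooth_real_subset[OF s \<open>W \<subseteq> V\<close>] _ E(1)]) (auto simp: W_def)
  \<comment> \<open>If \<open>v $ i = 0\<close>, then \<open>p\<close> vanishes on \<open>V\<close> and both sides of the equation below are \<open>0\<close>.\<close>
  from smooth_real_mult[OF W smooth_real_const[OF W, of "1 / v $ i"] this]
  have "smooth_real n W (\<lambda>w. F (p w) / pivot (p w))"
  proof (rule smooth_real_cong[OF W, rotated])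
    fix w assume w: "w \<in> W"
    then have wV: "w \<in> V" and sw: "s w \<in> {-e<..<e}"
      by (auto simp: W_def)
    show "1 / v $ i * E 0 (s w) = F (p w) / pivot (p w)"
    proof (cases "s w = 0")
      case True
      then show ?thesis
        using ps[OF wV] F0 E(3) D1 by simp
    next
      case False
      have "F (p w) = s w * E 0 (s w)"
        using E(2)[OF sw] ps[OF wV] F0 by (simp add: D0)
      moreover have "pivot (p w) = s w * v $ i"
        using bspec[OF i wV] arg_cong[OF ps[OF wV], of "\<lambda>x. x $ i"] by simp
      ultimately show ?thesis
        using False by simp
    qed
  qed
  moreover have "u \<in> W"
    using V(4,5) e(1) by (simp add: W_def s_def)
  ultimately show ?thesis
    using that[OF W _ \<open>W \<subseteq> V\<close>] by blast
qed

lemma quotient_by_pivot_rep: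
  assumes rep: "(B, F) \<in> pencil.reps" and F0: "F 0 = 0"
    and ker: "\<forall>L\<in>RP1. line_derivative F L = (\<lambda>x\<in>L. 0)"
  shows "(B \<inter> off_parabolas, \<lambda>y\<in>B \<inter> off_parabolas. F y / pivot y) \<in> pencil.reps"
  unfolding pencil.germ_reps_iff
proof (intro conjI allI impI)
  show "B \<inter> off_parabolas \<in> D_nbhds pencil 0"
    using rep off_parabolas_D_nbhd by (simp add: pencil.germ_reps_iff D_nbhds_Int)
  fix n U p assume "(n, U, p) \<in> plots pencil \<and> p ` U \<subseteq> B \<inter> off_parabolas"
  then have p: "(n, U, p) \<in> plots pencil" and sub: "p ` U \<subseteq> B" "p ` U \<subseteq> off_parabolas"
    by simp_all
  note U = pencil.openin_plot_domain[OF p]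
  have Fp: "smooth_real n U (\<lambda>u. F (p u))"
    using rep p sub(1) by (simp add: pencil.germ_reps_iff)
  have "smooth_real n U (\<lambda>u. F (p u) / pivot (p u))"
  proof (rule smooth_real_local[OF U])
    fix u assume u: "u \<in> U"
    with sub have "p u \<in> off_parabolas"
      by blast
    then obtain V i where V: "openin (Euclidean_space n) V" "u \<in> V" "V \<subseteq> U" "p ` V \<subseteq> off_parabolas"
      "smooth_euclidean n V p" "\<forall>w\<in>V. pivot (p w) = p w $ i \<and> (p w $ i = 0 \<longrightarrow> p w = 0)"
      "0 \<notin> p ` V \<or> (\<exists>L\<in>RP1. p ` V \<subseteq> L)"
      by (rule pivot_along_plot[OF p u])
    show "\<exists>V. openin (Euclidean_space n) V \<and> u \<in> V \<and> V \<subseteq> U \<and>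
        smooth_real n V (\<lambda>u. F (p u) / pivot (p u))"
    proof (cases "p u = 0")
      case True
      then obtain L where L: "L \<in> RP1" "p ` V \<subseteq> L"
        using V(2,7) by force
      obtain W where "openin (Euclidean_space n) W" "u \<in> W" "W \<subseteq> V"
        "smooth_real n W (\<lambda>w. F (p w) / pivot (p w))"
        by (rule quotient_by_pivot_smooth_on_line[OF rep F0 L(1) bspec[OF ker L(1)] V(1,5) L(2) V(2) True V(6)])
      with V(3) show ?thesis
        by blast
    next
      case False
      let ?W = "{w \<in> V. p w \<in> - {0}}"
      \<comment> \<open>Away from the origin the pivot has no zeros.\<close>
      have W: "openin (Euclidean_space n) ?W"
        by (rule openin_Euclidean_preimage[OF V(1) smooth_euclidean_continuous_on[OF V(1,5)]]) auto
      have nz: "p w $ i \<noteq> 0" if "w \<in> ?W" for w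
        using V(6) that by auto
      have "smooth_real n ?W (\<lambda>w. F (p w) / p w $ i)"
        by (rule smooth_real_divide[OF W smooth_real_subset[OF Fp]
              smooth_real_subset[OF smooth_euclidean_component[OF V(1,5)]] nz]) (use V(3) in auto)
      then have "smooth_real n ?W (\<lambda>w. F (p w) / pivot (p w))"
        by (rule smooth_real_cong[OF W, rotated]) (use V(6) in auto)
      with W V(2,3) False show ?thesis
        by (intro exI[of _ ?W]) auto
    qed
  qed
  then show "smooth_real n U (\<lambda>u. (\<lambda>y\<in>B \<inter> off_parabolas. F y / pivot y) (p u))"
    by (rule smooth_real_cong[OF U, rotated]) (use sub in auto)
qed simp

text \<open>
  The factors are the pivot and the quotient of \<open>f\<close> by the pivot. Both vanish at the origin, the quotient by
  the convention for division by zero.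
\<close>
lemma J_tilde_zero_imp_factor:
  assumes f: "f \<in> pencil.vanishing" and J: "\<forall>L\<in>RP1. J_tilde f L = (\<lambda>x\<in>L. 0)"
  obtains g h where "g \<in> pencil.vanishing" "h \<in> pencil.vanishing" "f = g \<otimes>\<^bsub>pencil.germs\<^esub> h"
proof -
  obtain B F where rep: "(B, F) \<in> pencil.reps" "f = pencil.cls (B, F)" and F0: "F 0 = 0"
    using f by (rule pencil.vanishing_idealE)
  have "\<forall>L\<in>RP1. line_derivative F L = (\<lambda>x\<in>L. 0)"
    using J J_tilde_class[OF rep(1)] unfolding rep(2) by simp
  note h = quotient_by_pivot_rep[OF rep(1) F0 this]
  let ?g = "pencil.cls (off_parabolas, restrict pivot off_parabolas)"
  let ?h = "pencil.cls (B \<inter> off_parabolas, \<lambda>y\<in>B \<inter> off_parabolas. F y / pivot y)"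
  note gh = pencil.germ_mult[OF pivot_rep h]
  have "pivot 0 = 0"
    by (simp add: pivot_def)
  then have "?g \<in> pencil.vanishing" "?h \<in> pencil.vanishing"
    unfolding pencil.germ_class_in_vanishing_ideal[OF pivot_rep] pencil.germ_class_in_vanishing_ideal[OF h]
    using F0 pencil.base_in_rep[OF h] by simp_all
  moreover have "f = ?g \<otimes>\<^bsub>pencil.germs\<^esub> ?h"
    unfolding gh(2) rep(2)
  proof (rule pencil.germ_class_eqI[OF rep(1) gh(1)])
    show "B \<inter> off_parabolas \<in> D_nbhds pencil 0"
      using h by (simp add: pencil.germ_reps_iff)
    fix y assume "y \<in> B \<inter> off_parabolas"
    then show "F y = (\<lambda>y\<in>off_parabolas \<inter> (B \<inter> off_parabolas). restrict pivot off_parabolas y *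
        (\<lambda>y\<in>B \<inter> off_parabolas. F y / pivot y) y) y"
      using pivot_nonzero[of y] F0 by (cases "y = 0") auto
  qed auto
  ultimately show ?thesis
    by (rule that)
qed

section \<open>The kernel and the Zariski cotangent space\<close>

lemma dual_product_zero: "\<zero>\<^bsub>dual_product\<^esub> = (\<lambda>L\<in>RP1. \<lambda>x\<in>L. 0)"
  by (simp add: dual_product_def product_space_def dual_space_def)

lemma J_tilde_kernel:
  "f \<in> a_kernel (vanishing_space pencil 0) dual_product J_tilde \<longleftrightarrow>
     f \<in> pencil.vanishing \<and> (\<forall>L\<in>RP1. J_tilde f L = (\<lambda>x\<in>L. 0))"
proof -
  have "J_tilde f = (\<lambda>L\<in>RP1. \<lambda>x\<in>L. 0) \<longleftrightarrow> (\<forall>L\<in>RP1. J_tilde f L = (\<lambda>x\<in>L. 0))"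
    by (auto simp: J_tilde_def restrict_def fun_eq_iff)
  then show ?thesis
    by (simp add: a_kernel_def' dual_product_zero vanishing_space_def)
qed

lemma kernel_J_tilde:
  "a_kernel (vanishing_space pencil 0) dual_product J_tilde = vanishing_ideal_sq pencil 0"
proof (intro subset_antisym subsetI)
  fix f assume "f \<in> a_kernel (vanishing_space pencil 0) dual_product J_tilde"
  then have "f \<in> pencil.vanishing" "\<forall>L\<in>RP1. J_tilde f L = (\<lambda>x\<in>L. 0)"
    by (simp_all add: J_tilde_kernel)
  then obtain g h where "g \<in> pencil.vanishing" "h \<in> pencil.vanishing" "f = g \<otimes>\<^bsub>pencil.germs\<^esub> h"
    by (rule J_tilde_zero_imp_factor)
  then show "f \<in> vanishing_ideal_sq pencil 0"
    by (simp add: vanishing_ideal_sq_def ideal_prod.prod)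
next
  fix f assume "f \<in> vanishing_ideal_sq pencil 0"
  then have "f \<in> ideal_prod pencil.germs pencil.vanishing pencil.vanishing"
    by (simp add: vanishing_ideal_sq_def)
  then have "f \<in> pencil.vanishing \<and> (\<forall>L\<in>RP1. J_tilde f L = (\<lambda>x\<in>L. 0))"
  proof induction
    case (prod g h)
    then show ?case
      by (simp add: pencil.vanishing_ideal_mult J_tilde_mult)
  next
    case (sum g h)
    then show ?case
      by (simp add: pencil.vanishing_ideal_add J_tilde_add cong: restrict_cong)
  qed
  then show "f \<in> a_kernel (vanishing_space pencil 0) dual_product J_tilde"
    by (simp add: J_tilde_kernel)
qed

lemma vanishing_ideal_sq_iff:
  "f \<in> vanishing_ideal_sq pencil 0 \<longleftrightarrow> f \<in> pencil.vanishing \<and> (\<forall>L\<in>RP1. J_tilde f L = (\<lambda>x\<in>L. 0))"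
  unfolding kernel_J_tilde[symmetric] by (rule J_tilde_kernel)

lemma mem_cotangent_class:
  "g \<in> cotangent_class pencil 0 f \<longleftrightarrow> (\<exists>z\<in>vanishing_ideal_sq pencil 0. g = z \<oplus>\<^bsub>pencil.germs\<^esub> f)"
  by (auto simp: cotangent_class_def a_r_coset_def' vanishing_space_def)

lemma cotangent_class_in_vanishing:
  assumes "f \<in> pencil.vanishing"
  shows "cotangent_class pencil 0 f \<subseteq> pencil.vanishing"
  using assms by (auto simp: mem_cotangent_class vanishing_ideal_sq_iff pencil.vanishing_ideal_add)

lemma J_tilde_cotangent_class:
  assumes f: "f \<in> pencil.vanishing" and g: "g \<in> cotangent_class pencil 0 f"
  shows "J_tilde g = J_tilde f"
proof -
  obtain z where "z \<in> vanishing_ideal_sq pencil 0" and g: "g = z \<oplus>\<^bsub>pencil.germs\<^esub> f"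
    using g unfolding mem_cotangent_class by blast
  then have z: "z \<in> pencil.vanishing" "\<forall>L\<in>RP1. J_tilde z L = (\<lambda>x\<in>L. 0)"
    by (simp_all add: vanishing_ideal_sq_iff)
  show ?thesis
  proof (rule extensionalityI[of _ RP1])
    fix L assume L: "L \<in> RP1"
    have "J_tilde g L = (\<lambda>x\<in>L. J_tilde f L x)"
      unfolding g J_tilde_add[OF z(1) f L] bspec[OF z(2) L] by (intro restrict_ext) simp
    also have "\<dots> = J_tilde f L"
      using L by (simp add: J_tilde_def line_derivative_def cong: restrict_cong)
    finally show "J_tilde g L = J_tilde f L" .
  qed (simp_all add: J_tilde_def)
qed

lemma cotangent_class_nonempty: "cotangent_class pencil 0 f \<noteq> {}"
proof -
  have "pencil.cls (off_parabolas, restrict pivot off_parabolas) \<in> pencil.vanishing"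
    unfolding pencil.germ_class_in_vanishing_ideal[OF pivot_rep] by (simp add: off_parabolas_def pivot_def)
  then have "vanishing_ideal_sq pencil 0 \<noteq> {}"
    unfolding vanishing_ideal_sq_def using ideal_prod.prod by fast
  then show ?thesis
    using mem_cotangent_class by blast
qed

text \<open>
  If \<open>J_tilde f = J_tilde g\<close>, then \<open>f - g\<close> lies in the kernel, which is the square of the vanishing
  ideal; so \<open>z + f = (z + (f - g)) + g\<close> belongs to the coset of \<open>g\<close> for every \<open>z\<close> in the kernel.
\<close>
lemma cotangent_class_subset_if_J_tilde_eq:
  assumes f: "f \<in> pencil.vanishing" and g: "g \<in> pencil.vanishing" and eq: "J_tilde f = J_tilde g"
  shows "cotangent_class pencil 0 f \<subseteq> cotangent_class pencil 0 g"
proof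
  fix h assume "h \<in> cotangent_class pencil 0 f"
  then obtain z where z: "z \<in> vanishing_ideal_sq pencil 0" and h: "h = z \<oplus>\<^bsub>pencil.germs\<^esub> f"
    unfolding mem_cotangent_class by blast
  define d where "d = f \<oplus>\<^bsub>pencil.germs\<^esub> ((- 1) \<odot>\<^bsub>pencil.germs\<^esub> g)"
  have mg: "(- 1) \<odot>\<^bsub>pencil.germs\<^esub> g \<in> pencil.vanishing"
    using g by (rule pencil.vanishing_ideal_smult)
  have d: "d \<in> pencil.vanishing"
    unfolding d_def using f mg by (rule pencil.vanishing_ideal_add)
  have zI: "z \<in> pencil.vanishing" "\<forall>L\<in>RP1. J_tilde z L = (\<lambda>x\<in>L. 0)"
    using z by (simp_all add: vanishing_ideal_sq_iff)
  have "J_tilde (z \<oplus>\<^bsub>pencil.germs\<^esub> d) L = (\<lambda>x\<in>L. 0)" if L: "L \<in> RP1" for L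
  proof -
    have "J_tilde d L = (\<lambda>x\<in>L. 0)"
      unfolding d_def J_tilde_add[OF f mg L] J_tilde_smult[OF g L] eq by (intro restrict_ext) simp
    then show ?thesis
      unfolding J_tilde_add[OF zI(1) d L] bspec[OF zI(2) L] by (intro restrict_ext) simp
  qed
  then have "z \<oplus>\<^bsub>pencil.germs\<^esub> d \<in> vanishing_ideal_sq pencil 0"
    by (simp add: vanishing_ideal_sq_iff pencil.vanishing_ideal_add[OF zI(1) d])
  moreover have "h = (z \<oplus>\<^bsub>pencil.germs\<^esub> d) \<oplus>\<^bsub>pencil.germs\<^esub> g"
    unfolding h d_def by (rule pencil.germ_add_diff_cancel[OF zI(1) f g, symmetric])
  ultimately show "h \<in> cotangent_class pencil 0 g"
    unfolding mem_cotangent_class by blast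
qed

lemma carrier_cotangent_space:
  "carrier (cotangent_space pencil 0) = cotangent_class pencil 0 ` pencil.vanishing"
  by (auto simp: cotangent_space_def quotient_space_def A_RCOSETS_def' cotangent_class_def vanishing_space_def)

text \<open>
  By \<open>J_tilde_cotangent_class\<close> the map \<open>J_tilde\<close> is constant on each coset, so the choice is immaterial.
\<close>
definition J_map :: "(real^2) germ set \<Rightarrow> (real^2) set \<Rightarrow> real^2 \<Rightarrow> real" where
  "J_map c = J_tilde (SOME g. g \<in> c)"

lemma J_map_class:
  assumes "f \<in> pencil.vanishing"
  shows "J_map (cotangent_class pencil 0 f) = J_tilde f"
  unfolding J_map_def
  by (rule J_tilde_cotangent_class[OF assms]) (simp add: some_in_eq cotangent_class_nonempty)

lemma J_map_carrier:
  assumes "c \<in> cotangent_class pencil 0 ` pencil.vanishing"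
  shows "J_map c \<in> carrier dual_product"
proof -
  obtain f where "f \<in> pencil.vanishing" "c = cotangent_class pencil 0 f"
    using assms by blast
  then show ?thesis
    by (simp add: J_map_class J_tilde_carrier)
qed

text \<open>
  Sums and multiples of cosets are sets of germs; to evaluate \<open>J_map\<close> on them it is enough to know
  \<open>J_tilde\<close> on their elements.
\<close>
lemma J_map_eqI:
  assumes "c \<noteq> {}" "\<And>g. g \<in> c \<Longrightarrow> J_tilde g = y"
  shows "J_map c = y"
  unfolding J_map_def by (rule assms(2)) (simp add: some_in_eq assms(1))

lemma J_map_linear: "linear_map (cotangent_space pencil 0) dual_product J_map"
proof -
  note lin = J_tilde_linear[unfolded linear_map_def]
  have sel: "carrier (vanishing_space pencil 0) = pencil.vanishing"
    "add (vanishing_space pencil 0) = add pencil.germs" "smult (vanishing_space pencil 0) = smult pencil.germs"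
    by (simp_all add: vanishing_space_def)
  have add: "J_tilde (f \<oplus>\<^bsub>pencil.germs\<^esub> g) = J_tilde f \<oplus>\<^bsub>dual_product\<^esub> J_tilde g"
    if "f \<in> pencil.vanishing" "g \<in> pencil.vanishing" for f g
    using lin that unfolding sel by (elim conjE) simp
  have smult: "J_tilde (a \<odot>\<^bsub>pencil.germs\<^esub> f) = a \<odot>\<^bsub>dual_product\<^esub> J_tilde f" if "f \<in> pencil.vanishing" for a f
    using lin that unfolding sel by (elim conjE) simp
  have add_class: "J_map (c \<oplus>\<^bsub>cotangent_space pencil 0\<^esub> d) = J_map c \<oplus>\<^bsub>dual_product\<^esub> J_map d"
    if "c \<in> cotangent_class pencil 0 ` pencil.vanishing" "d \<in> cotangent_class pencil 0 ` pencil.vanishing" for c d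
  proof -
    obtain f where f: "f \<in> pencil.vanishing" "c = cotangent_class pencil 0 f"
      using \<open>c \<in> _\<close> by blast
    obtain g where g: "g \<in> pencil.vanishing" "d = cotangent_class pencil 0 g"
      using \<open>d \<in> _\<close> by blast
    have sum: "c \<oplus>\<^bsub>cotangent_space pencil 0\<^esub> d = (\<Union>x\<in>c. \<Union>y\<in>d. {x \<oplus>\<^bsub>pencil.germs\<^esub> y})"
      by (simp add: cotangent_space_def quotient_space_def set_add_def' vanishing_space_def)
    show ?thesis
    proof (rule J_map_eqI)
      show "c \<oplus>\<^bsub>cotangent_space pencil 0\<^esub> d \<noteq> {}"
        unfolding sum using cotangent_class_nonempty[of f] cotangent_class_nonempty[of g] f(2) g(2)
        by simp
      fix h assume "h \<in> c \<oplus>\<^bsub>cotangent_space pencil 0\<^esub> d"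
      then obtain x y where x: "x \<in> c" and y: "y \<in> d" and h: "h = x \<oplus>\<^bsub>pencil.germs\<^esub> y"
        unfolding sum by blast
      have "x \<in> pencil.vanishing" "y \<in> pencil.vanishing"
        using x y cotangent_class_in_vanishing[OF f(1)] cotangent_class_in_vanishing[OF g(1)] f(2) g(2) by auto
      then have "J_tilde h = J_tilde x \<oplus>\<^bsub>dual_product\<^esub> J_tilde y"
        unfolding h by (rule add)
      then show "J_tilde h = J_map c \<oplus>\<^bsub>dual_product\<^esub> J_map d"
        unfolding J_tilde_cotangent_class[OF f(1) x[unfolded f(2)]]
          J_tilde_cotangent_class[OF g(1) y[unfolded g(2)]]
        unfolding f(2) g(2) J_map_class[OF f(1)] J_map_class[OF g(1)] .
    qed
  qed
  have smult_class: "J_map (a \<odot>\<^bsub>cotangent_space pencil 0\<^esub> c) = a \<odot>\<^bsub>dual_product\<^esub> J_map c"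
    if "c \<in> cotangent_class pencil 0 ` pencil.vanishing" for a c
  proof -
    obtain f where f: "f \<in> pencil.vanishing" "c = cotangent_class pencil 0 f"
      using \<open>c \<in> _\<close> by blast
    have scaled: "a \<odot>\<^bsub>cotangent_space pencil 0\<^esub> c = (\<Union>x\<in>c. cotangent_class pencil 0 (a \<odot>\<^bsub>pencil.germs\<^esub> x))"
      by (simp add: cotangent_space_def quotient_space_def cotangent_class_def vanishing_space_def)
    show ?thesis
    proof (rule J_map_eqI)
      show "a \<odot>\<^bsub>cotangent_space pencil 0\<^esub> c \<noteq> {}"
        unfolding scaled using cotangent_class_nonempty f(2) by simp
      fix h assume "h \<in> a \<odot>\<^bsub>cotangent_space pencil 0\<^esub> c"
      then obtain x where x: "x \<in> c" and h: "h \<in> cotangent_class pencil 0 (a \<odot>\<^bsub>pencil.germs\<^esub> x)"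
        unfolding scaled by blast
      have xI: "x \<in> pencil.vanishing"
        using x cotangent_class_in_vanishing[OF f(1)] f(2) by auto
      have "J_tilde h = a \<odot>\<^bsub>dual_product\<^esub> J_tilde x"
        unfolding J_tilde_cotangent_class[OF pencil.vanishing_ideal_smult[OF xI] h] by (rule smult[OF xI])
      then show "J_tilde h = a \<odot>\<^bsub>dual_product\<^esub> J_map c"
        unfolding J_tilde_cotangent_class[OF f(1) x[unfolded f(2)]]
        unfolding f(2) J_map_class[OF f(1)] .
    qed
  qed
  show ?thesis
    unfolding linear_map_def carrier_cotangent_space
    by (intro conjI funcsetI ballI allI J_map_carrier add_class smult_class)
qed

lemma J_map_smooth: "diff_smooth (diff_cotangent pencil 0) diff_dual_product J_map"
  unfolding diff_smooth_def
proof (intro conjI allI impI)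
  have "points (diff_cotangent pencil 0) = cotangent_class pencil 0 ` pencil.vanishing"
    by (simp add: diff_cotangent_def diff_quot_def diff_vanishing_def diff_sub_def)
  then show "J_map \<in> points (diff_cotangent pencil 0) \<rightarrow> points diff_dual_product"
    unfolding points_diff_dual_product by (intro funcsetI) (simp only: J_map_carrier)
  fix n U p assume p: "(n, U, p) \<in> plots (diff_cotangent pencil 0)"
  have U: "openin (Euclidean_space n) U"
    using p by (simp add: diff_cotangent_def diff_quot_def parametrizations_def)
  have lift: "\<forall>u\<in>U. \<exists>V q. openin (Euclidean_space n) V \<and> u \<in> V \<and> V \<subseteq> U \<and>
      (n, V, q) \<in> plots (diff_vanishing pencil 0) \<and> (\<forall>w\<in>V. p w = cotangent_class pencil 0 (q w))"
    using p by (simp add: diff_cotangent_def diff_quot_def)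
  show "(n, U, J_map \<circ> p) \<in> plots diff_dual_product"
  proof (rule diff_dual_product_local[OF U])
    fix u assume "u \<in> U"
    from bspec[OF lift this] obtain V q
      where V: "openin (Euclidean_space n) V" "u \<in> V" "V \<subseteq> U"
        and q: "(n, V, q) \<in> plots (diff_vanishing pencil 0)" "\<forall>w\<in>V. p w = cotangent_class pencil 0 (q w)"
      by blast
    have "(n, V, J_tilde \<circ> q) \<in> plots diff_dual_product"
      using J_tilde_smooth q(1) unfolding diff_smooth_def by blast
    moreover have "(J_map \<circ> p) w = (J_tilde \<circ> q) w" if "w \<in> V" for w
    proof -
      have "q w \<in> pencil.vanishing"
        using q(1) that by (auto simp: diff_vanishing_def diff_sub_def)
      then show ?thesis
        using q(2) that J_map_class by simp
    qed
    ultimately show "\<exists>V q. openin (Euclidean_space n) V \<and> u \<in> V \<and> V \<subseteq> U \<and>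
        (n, V, q) \<in> plots diff_dual_product \<and> (\<forall>w\<in>V. (J_map \<circ> p) w = q w)"
      using V by blast
  qed
qed

lemma J_map_inj: "inj_on J_map (carrier (cotangent_space pencil 0))"
  unfolding carrier_cotangent_space
proof (rule inj_onI)
  fix c d assume "c \<in> cotangent_class pencil 0 ` pencil.vanishing" "d \<in> cotangent_class pencil 0 ` pencil.vanishing"
    and eq: "J_map c = J_map d"
  then obtain f g where f: "f \<in> pencil.vanishing" "c = cotangent_class pencil 0 f"
    and g: "g \<in> pencil.vanishing" "d = cotangent_class pencil 0 g"
    by blast
  then have "J_tilde f = J_tilde g"
    using eq J_map_class by simp
  then show "c = d"
    using cotangent_class_subset_if_J_tilde_eq[OF f(1) g(1)] cotangent_class_subset_if_J_tilde_eq[OF g(1) f(1)] f(2) g(2) by simp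
qed

theorem theorem3p8:
  shows
    "(\<forall>f\<in>vanishing_ideal pencil 0. \<forall>(B, F)\<in>f. \<forall>L\<in>RP1.
        F differentiable (at 0 within L) \<and> J_tilde f L = line_derivative F L) \<and>
     linear_map (vanishing_space pencil 0) dual_product J_tilde \<and>
     diff_smooth (diff_vanishing pencil 0) diff_dual_product J_tilde \<and>
     a_kernel (vanishing_space pencil 0) dual_product J_tilde = vanishing_ideal_sq pencil 0 \<and>
     (\<exists>J. (\<forall>f\<in>vanishing_ideal pencil 0. J (cotangent_class pencil 0 f) = J_tilde f) \<and>
        linear_map (cotangent_space pencil 0) dual_product J \<and>
        diff_smooth (diff_cotangent pencil 0) diff_dual_product J \<and>
        inj_on J (carrier (cotangent_space pencil 0)))"
proof (intro conjI ballI)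
  fix f r assume f: "f \<in> pencil.vanishing" and r: "r \<in> f"
  obtain B F where BF: "r = (B, F)"
    by (cases r)
  obtain B' F' where f': "(B', F') \<in> pencil.reps" "f = pencil.cls (B', F')"
    using f by (rule pencil.vanishing_idealE)
  have "(B, F) \<in> pencil.cls (B', F')"
    using r unfolding BF f'(2) .
  then obtain C where C: "(B, F) \<in> pencil.reps" "(B', F') \<in> pencil.reps" "C \<in> D_nbhds pencil 0"
    "C \<subseteq> B' \<inter> B" "\<forall>y\<in>C. F' y = F y"
    by (rule pencil.germ_classE)
  have "f = pencil.cls (B, F)"
    unfolding f'(2) by (rule pencil.germ_class_eqI[OF C(2,1,3,4)]) (simp add: C(5))
  then show "case r of (B, F) \<Rightarrow> \<forall>L\<in>RP1.
      F differentiable (at 0 within L) \<and> J_tilde f L = line_derivative F L"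
    using rep_differentiable[OF C(1)] J_tilde_class[OF C(1)] by (simp add: BF)
next
  show "\<exists>J. (\<forall>f\<in>vanishing_ideal pencil 0. J (cotangent_class pencil 0 f) = J_tilde f) \<and>
        linear_map (cotangent_space pencil 0) dual_product J \<and>
        diff_smooth (diff_cotangent pencil 0) diff_dual_product J \<and>
        inj_on J (carrier (cotangent_space pencil 0))"
    by (intro exI[of _ J_map] conjI ballI J_map_class J_map_linear J_map_smooth J_map_inj)
qed (rule J_tilde_linear J_tilde_smooth kernel_J_tilde)+

end
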